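(* For all positive integers $k,a,b$ with $a,b\le n$, $$\rho(r_k^{\mathfrak{gl}(n+1)}(a,b))=\sum_{m=1}^k\left(f_m(a,b)\sum_{g=0}^{k-m}\binom kgR_1^gR_2^{k-m-g}\right)+\sum_{g=0}^k\binom kgR_1^g\left(1\otimes r_{k-g}^{\mathfrak{gl}(n)}(a,b)\right),$$ $$\begin{aligned}\rho(r_k^{\mathfrak{gl}(n+1)}(a,0))={}&\left(\sum_{g=0}^{k-1}\binom kgR_1^gR_2^{k-1-g}\right)(t_a\partial_0\otimes1)-\sum_{g=0}^{k-1}\left(\binom kgR_1^g\sum_{j>0}\frac{t_j}{t_0}\otimes r_{k-g}^{\mathfrak{gl}(n)}(a,j)\right)\\&-\left(\frac{t_a}{t_0}\otimes1\right)\sum_{m=2}^k\left(\sum_{g=0}^{k-m}\binom kgR_1^gR_2^{k-m-g}\right)\left(\sum_{i,j>0}\partial_it_j\otimes r_{m-1}^{\mathfrak{gl}(n)}(i,j)\right),\end{aligned}$$ $$\rho(r_k^{\mathfrak{gl}(n+1)}(0,b))=\sum_{m=1}^k\left(f_m(0,b)\sum_{g=0}^{k-m}\binom kgR_1^gR_2^{k-m-g}\right),$$ $$\begin{aligned}\rho(r_k^{\mathfrak{gl}(n+1)}(0,0))={}&\left(\sum_{g=0}^{k-1}\binom kgR_1^gR_2^{k-1-g}\right)(t_0\partial_0\otimes1)+R_1^k\\&-\sum_{m=2}^k\left(\sum_{g=0}^{k-m}\binom kgR_1^gR_2^{k-m-g}\right)\left(\sum_{i,j>0}\partial_it_j\otimes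 r_{m-1}^{\mathfrak{gl}(n)}(i,j)\right).\end{aligned}$$
   Context: The base field is $\mathbb C$ and $n$ is a fixed positive integer. $E_{ij}$ are the elementary matrices; indices run over $1,\dots,n$ for $\mathfrak{gl}(n)$ and over $0,\dots,n$ for $\mathfrak{gl}(n+1)$. A sum $\sum_{i=r}^s$ with $r>s$ is $0$; sums over $i>0$, $j>0$ run over $1,\dots,n$. $\mathcal D'(n)$ is the subalgebra of the algebra of differential operators on $\mathbb C[t_0^{\pm1},t_1,\dots,t_n]$ generated by $\frac{t_i}{t_0}$ ($1\le i\le n$) and $t_0\partial_j$ ($0\le j\le n$), where $\partial_j=\partial/\partial t_j$; $\mathcal E=\sum_{i=0}^n t_i\partial_i$. The product $\partial_it_j$ is the composition of operators, i.e. $\partial_it_j=t_j\partial_i+\delta_{ij}$. Put $R_1=-\frac1{n+1}\left(\mathcal E\otimes1+1\otimes\sum_{i=1}^nE_{ii}\right)$ and $R_2=(\mathcal E+n)\otimes1$, both central in $\mathcal D'(n)\otimes U(\mathfrak{gl}(n))$. The map $\rho:U(\mathfrak{gl}(n+1))\to\mathcal D'(n)\otimes U(\mathfrak{gl}(n))$ is the homomorphism of associative unital algebras determined by $E_{ab}\mapsto t_a\partial_b\otimes1+1\otimes E_{ab}+\delta_{ab}R_1$ for $a,b>0$; $E_{a0}\mapsto t_a\partial_0\otimes1-\sum_{i>0}\frac{t_i}{t_0}\otimes E_{ai}$ for $a>0$; $E_{0b}\mapsto t_0\partial_b\otimes1$ for $b>0$; $E_{00}\mapsto t_0\partial_0\otimes1+R_1$.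 For $N\in\{n,n+1\}$ set $r_0^{\mathfrak{gl}(N)}(a,b)=\delta_{ab}$ and $r_{k+1}^{\mathfrak{gl}(N)}(a,b)=\sum_{i_1,\dots,i_k}E_{ai_1}E_{i_1i_2}\cdots E_{i_kb}\in U(\mathfrak{gl}(N))$ for $k\ge0$ (so $r_1^{\mathfrak{gl}(N)}(a,b)=E_{ab}$), the sum over all indices $i_1,\dots,i_k$ in $\{1,\dots,n\}$ if $N=n$ and in $\{0,\dots,n\}$ if $N=n+1$. For a positive integer $m$ and $0\le a\le n$, $1\le b\le n$, set $f_m(a,b)=\sum_{i=1}^nt_a\partial_i\otimes r_{m-1}^{\mathfrak{gl}(n)}(i,b)$. *)

theory Defs
  imports "HOL-Analysis.Analysis" "HOL-Library.Poly_Mapping"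
begin

section \<open>Associative unital algebras over the complex numbers\<close>

class complex_algebra_1 = ring_1 +
  fixes scaleC :: "complex \<Rightarrow> 'a \<Rightarrow> 'a"  (infixr \<open>*\<^sub>C\<close> 75)
  assumes scaleC_add_right: "c *\<^sub>C (x + y) = c *\<^sub>C x + c *\<^sub>C y"
    and scaleC_add_left: "(c + d) *\<^sub>C x = c *\<^sub>C x + d *\<^sub>C x"
    and scaleC_scaleC [simp]: "c *\<^sub>C d *\<^sub>C x = (c * d) *\<^sub>C x"
    and scaleC_one [simp]: "1 *\<^sub>C x = x"
    and mult_scaleC_left [simp]: "(c *\<^sub>C x) * y = c *\<^sub>C (x * y)"
    and mult_scaleC_right [simp]: "x * (c *\<^sub>C y) = c *\<^sub>C (x * y)"
begin

lemma scaleC_zero_right [simp]: "c *\<^sub>C 0 = 0"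
  using scaleC_add_right[of c 0 0] by simp

lemma scaleC_zero_left [simp]: "0 *\<^sub>C x = 0"
  using scaleC_add_left[of 0 0 x] by simp

lemma scaleC_minus_right [simp]: "c *\<^sub>C (- x) = - (c *\<^sub>C x)"
  using scaleC_add_right[of c x "- x"] by (simp add: eq_neg_iff_add_eq_0 add.commute)

lemma scaleC_minus_left [simp]: "(- c) *\<^sub>C x = - (c *\<^sub>C x)"
  using scaleC_add_left[of c "- c" x] by (simp add: eq_neg_iff_add_eq_0 add.commute)

lemma scaleC_diff_right: "c *\<^sub>C (x - y) = c *\<^sub>C x - c *\<^sub>C y"
  using scaleC_add_right[of c x "- y"] by simp

lemma scaleC_diff_left: "(c - d) *\<^sub>C x = c *\<^sub>C x - d *\<^sub>C x"
  using scaleC_add_left[of c "- d" x] by simp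

lemma scaleC_sum_right: "c *\<^sub>C sum f A = (\<Sum>x\<in>A. c *\<^sub>C f x)"
  by (induction A rule: infinite_finite_induct) (simp_all add: scaleC_add_right)

lemma scaleC_sum_left: "sum f A *\<^sub>C x = (\<Sum>a\<in>A. f a *\<^sub>C x)"
  by (induction A rule: infinite_finite_induct) (simp_all add: scaleC_add_left)

end

definition algebra_hom :: "('a::complex_algebra_1 \<Rightarrow> 'b::complex_algebra_1) \<Rightarrow> bool" where
  "algebra_hom h \<longleftrightarrow>
     h 1 = 1 \<and> (\<forall>x y. h (x + y) = h x + h y) \<and> (\<forall>x y. h (x * y) = h x * h y)
     \<and> (\<forall>c x. h (c *\<^sub>C x) = c *\<^sub>C h x)"

instantiation complex :: complex_algebra_1
begin
definition scaleC_complex :: "complex \<Rightarrow> complex \<Rightarrow> complex" where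
  "scaleC_complex c x = c * x"
instance by standard (simp_all add: scaleC_complex_def algebra_simps)
end

lemma monoid_algebra_induct [case_names single add]:
  fixes p :: "'a \<Rightarrow>\<^sub>0 'b::comm_monoid_add"
  assumes single: "\<And>k v. P (Poly_Mapping.single k v)"
    and add: "\<And>p q. P p \<Longrightarrow> P q \<Longrightarrow> P (p + q)"
  shows "P p"
proof (induction p rule: update_induct)
  case const
  show ?case using single[of undefined 0] by simp
next
  case (update f a b)
  have "Poly_Mapping.update a b f = f + Poly_Mapping.single a b"
    using update(1)
    by (intro poly_mapping_eqI) (auto simp: lookup_update lookup_add lookup_single in_keys_iff when_def)
  thus ?case using add[OF update.IH single] by simp
qed

text \<open>For a monoid written additively, the type of finitely supported functions carries the
  convolution product, i.e. it is the monoid algebra.\<close>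

instantiation poly_mapping :: (monoid_add, complex_algebra_1) complex_algebra_1
begin
definition scaleC_poly_mapping :: "complex \<Rightarrow> ('a \<Rightarrow>\<^sub>0 'b) \<Rightarrow> ('a \<Rightarrow>\<^sub>0 'b)" where
  "scaleC_poly_mapping c p = Poly_Mapping.map ((*\<^sub>C) c) p"

lemma scaleC_poly_mapping_altdef:
  "c *\<^sub>C (p :: 'a \<Rightarrow>\<^sub>0 'b) = Poly_Mapping.single 0 (c *\<^sub>C 1) * p"
proof -
  have "Poly_Mapping.map ((*\<^sub>C) c) p = Poly_Mapping.map ((*) (c *\<^sub>C 1)) p"
    by (rule arg_cong2[where f = Poly_Mapping.map]) auto
  thus ?thesis
    by (simp add: scaleC_poly_mapping_def mult_map_scale_conv_mult)
qed

lemma single_0_scaleC_commute: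
  "(p :: 'a \<Rightarrow>\<^sub>0 'b) * Poly_Mapping.single 0 (c *\<^sub>C 1) = Poly_Mapping.single 0 (c *\<^sub>C 1) * p"
  by (induction p rule: monoid_algebra_induct) (simp_all add: mult_single algebra_simps)

instance
proof
  fix c d :: complex and x y :: "'a \<Rightarrow>\<^sub>0 'b"
  show "c *\<^sub>C (x + y) = c *\<^sub>C x + c *\<^sub>C y"
    by (simp add: scaleC_poly_mapping_altdef algebra_simps)
  show "(c + d) *\<^sub>C x = c *\<^sub>C x + d *\<^sub>C x"
    by (simp add: scaleC_poly_mapping_altdef algebra_simps scaleC_add_left single_add)
  show "c *\<^sub>C d *\<^sub>C x = (c * d) *\<^sub>C x"
    by (simp add: scaleC_poly_mapping_altdef mult.assoc[symmetric] mult_single mult.commute[of d])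
  show "1 *\<^sub>C x = x"
    by (simp add: scaleC_poly_mapping_altdef)
  show "(c *\<^sub>C x) * y = c *\<^sub>C (x * y)"
    by (simp add: scaleC_poly_mapping_altdef mult.assoc)
  show "x * (c *\<^sub>C y) = c *\<^sub>C (x * y)"
    by (simp add: scaleC_poly_mapping_altdef mult.assoc[symmetric] single_0_scaleC_commute)
qed
end

lemma scaleC_single [simp]:
  "c *\<^sub>C Poly_Mapping.single k x = Poly_Mapping.single k (c *\<^sub>C x)"
  by (simp add: scaleC_poly_mapping_altdef mult_single)

lemma lookup_scaleC [simp]: "Poly_Mapping.lookup (c *\<^sub>C p) k = c *\<^sub>C Poly_Mapping.lookup p k"
  by (simp add: scaleC_poly_mapping_def Poly_Mapping.map.rep_eq when_def)

definition lin_ext :: "('m::monoid_add \<Rightarrow> 'b::complex_algebra_1) \<Rightarrow> ('m \<Rightarrow>\<^sub>0 complex) \<Rightarrow> 'b" where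
  "lin_ext h p = (\<Sum>w\<in>Poly_Mapping.keys p. Poly_Mapping.lookup p w *\<^sub>C h w)"

lemma lin_ext_superset:
  assumes "finite A" "Poly_Mapping.keys p \<subseteq> A"
  shows "lin_ext h p = (\<Sum>w\<in>A. Poly_Mapping.lookup p w *\<^sub>C h w)"
  unfolding lin_ext_def using assms
  by (intro sum.mono_neutral_left) (auto simp: in_keys_iff)

lemma lin_ext_add: "lin_ext h (p + q) = lin_ext h p + lin_ext h q"
proof -
  let ?A = "Poly_Mapping.keys p \<union> Poly_Mapping.keys q"
  have "Poly_Mapping.keys (p + q) \<subseteq> ?A" by (rule Poly_Mapping.keys_add)
  thus ?thesis
    by (simp add: lin_ext_superset[of ?A] lookup_add scaleC_add_left sum.distrib)
qed

lemma lin_ext_single [simp]: "lin_ext h (Poly_Mapping.single w c) = c *\<^sub>C h w"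
  by (simp add: lin_ext_def)

lemma lin_ext_zero [simp]: "lin_ext h 0 = 0"
  by (simp add: lin_ext_def)

lemma lin_ext_scaleC: "lin_ext h (c *\<^sub>C p) = c *\<^sub>C lin_ext h p"
  by (induction p rule: monoid_algebra_induct)
     (simp_all add: lin_ext_add scaleC_add_right scaleC_complex_def)

lemma lin_ext_diff: "lin_ext h (p - q) = lin_ext h p - lin_ext h q"
  using lin_ext_add[of h "p - q" q] by simp

lemma lin_ext_mult:
  assumes "\<And>v w. h (v + w) = h v * h w"
  shows "lin_ext h (p * q) = lin_ext h p * lin_ext h q"
proof (induction p rule: monoid_algebra_induct)
  case (single k v)
  show ?case
    by (induction q rule: monoid_algebra_induct)
       (simp_all add: mult_single assms algebra_simps lin_ext_add scaleC_add_right)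
qed (simp_all add: algebra_simps lin_ext_add)

lemma algebra_hom_lin_ext:
  assumes "h 0 = 1" "\<And>v w. h (v + w) = h v * h w"
  shows "algebra_hom (lin_ext h)"
  unfolding algebra_hom_def
  using lin_ext_single[of h 0 1]
  by (simp add: lin_ext_add lin_ext_mult lin_ext_scaleC assms del: lin_ext_single)

inductive_set two_sided_ideal :: "'a::ring_1 set \<Rightarrow> 'a set" for S where
  ideal_zero: "0 \<in> two_sided_ideal S"
| ideal_gen: "x \<in> S \<Longrightarrow> x \<in> two_sided_ideal S"
| ideal_add: "x \<in> two_sided_ideal S \<Longrightarrow> y \<in> two_sided_ideal S \<Longrightarrow> x + y \<in> two_sided_ideal S"
| ideal_mult: "x \<in> two_sided_ideal S \<Longrightarrow> a * x * b \<in> two_sided_ideal S"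

lemma ideal_uminus: "x \<in> two_sided_ideal S \<Longrightarrow> - x \<in> two_sided_ideal S"
  using ideal_mult[of x S "- 1" 1] by simp

lemma ideal_uminus_iff: "- x \<in> two_sided_ideal S \<longleftrightarrow> x \<in> two_sided_ideal S"
  using ideal_uminus[of x S] ideal_uminus[of "- x" S] by auto

lemma ideal_diff: "x \<in> two_sided_ideal S \<Longrightarrow> y \<in> two_sided_ideal S \<Longrightarrow> x - y \<in> two_sided_ideal S"
  using ideal_add[of x S "- y"] ideal_uminus[of y S] by simp

lemma ideal_left: "x \<in> two_sided_ideal S \<Longrightarrow> a * x \<in> two_sided_ideal S"
  using ideal_mult[of x S a 1] by simp

lemma ideal_right: "x \<in> two_sided_ideal S \<Longrightarrow> x * a \<in> two_sided_ideal S"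
  using ideal_mult[of x S 1 a] by simp

lemma ideal_scaleC: "x \<in> two_sided_ideal S \<Longrightarrow> c *\<^sub>C x \<in> two_sided_ideal S"
  using ideal_left[of x S "c *\<^sub>C 1"] by simp

lemma ideal_equivp: "equivp (\<lambda>p q. p - q \<in> two_sided_ideal S)"
proof (rule equivpI)
  show "reflp (\<lambda>p q. p - q \<in> two_sided_ideal S)"
    by (simp add: reflp_def ideal_zero)
  show "symp (\<lambda>p q. p - q \<in> two_sided_ideal S)"
    unfolding symp_def using ideal_uminus by fastforce
  show "transp (\<lambda>p q. p - q \<in> two_sided_ideal S)"
    unfolding transp_def using ideal_add by fastforce
qed

lemma ideal_cong_add:
  "p - p' \<in> two_sided_ideal S \<Longrightarrow> q - q' \<in> two_sided_ideal S \<Longrightarrow>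
    (p + q) - (p' + q') \<in> two_sided_ideal S"
  using ideal_add[of "p - p'" S "q - q'"] by (simp add: algebra_simps)

lemma ideal_cong_uminus:
  "p - p' \<in> two_sided_ideal S \<Longrightarrow> (- p) - (- p') \<in> two_sided_ideal S"
  using ideal_uminus[of "p - p'" S] by (simp add: algebra_simps)

lemma ideal_cong_diff:
  "p - p' \<in> two_sided_ideal S \<Longrightarrow> q - q' \<in> two_sided_ideal S \<Longrightarrow>
    (p - q) - (p' - q') \<in> two_sided_ideal S"
  using ideal_diff[of "p - p'" S "q - q'"] by (simp add: algebra_simps)

lemma ideal_cong_mult:
  "p - p' \<in> two_sided_ideal S \<Longrightarrow> q - q' \<in> two_sided_ideal S \<Longrightarrow>
    (p * q) - (p' * q') \<in> two_sided_ideal S"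
  using ideal_add[OF ideal_right[of "p - p'" S q] ideal_left[of "q - q'" S p']]
  by (simp add: algebra_simps)

lemma ideal_cong_scaleC:
  "p - p' \<in> two_sided_ideal S \<Longrightarrow> c *\<^sub>C p - c *\<^sub>C p' \<in> two_sided_ideal S"
  using ideal_scaleC[of "p - p'" S c] by (simp add: scaleC_diff_right)

lemma algebra_hom_ideal:
  assumes "algebra_hom h" "\<And>x. x \<in> S \<Longrightarrow> h x = 0" "x \<in> two_sided_ideal S"
  shows "h x = 0"
  using assms(3)
proof induction
  case ideal_zero
  show ?case using assms(1) unfolding algebra_hom_def by (metis add_cancel_right_right)
qed (use assms in \<open>auto simp: algebra_hom_def\<close>)


section \<open>The universal enveloping algebra of gl(N)\<close>

text \<open>Words form the free monoid; its algebra is the free algebra on the given letters.\<close>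

datatype 'a word = Word "'a list"

instantiation word :: (type) monoid_add
begin
definition zero_word :: "'a word" where "0 = Word []"
fun plus_word :: "'a word \<Rightarrow> 'a word \<Rightarrow> 'a word" where "Word u + Word v = Word (u @ v)"
instance
proof
  fix a b c :: "'a word"
  show "a + b + c = a + (b + c)" by (cases a; cases b; cases c) simp
  show "0 + a = a" "a + 0 = a" by (cases a; simp add: zero_word_def)+
qed
end

type_synonym 'i gl = "complex ^ 'i ^ 'i"

definition gl_bracket :: "'i::finite gl \<Rightarrow> 'i gl \<Rightarrow> 'i gl" where
  "gl_bracket x y = x ** y - y ** x"

definition gl_scale :: "complex \<Rightarrow> 'i::finite gl \<Rightarrow> 'i gl" where
  "gl_scale c x = (\<chi> i j. c * x $ i $ j)"

definition elem_matrix :: "'i::finite \<Rightarrow> 'i \<Rightarrow> 'i gl" where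
  "elem_matrix i j = (\<chi> p q. if p = i \<and> q = j then 1 else 0)"

definition letter :: "'a \<Rightarrow> 'a word \<Rightarrow>\<^sub>0 complex" where
  "letter x = Poly_Mapping.single (Word [x]) 1"

text \<open>The first two families of relations turn the free algebra on the underlying set of gl(N)
  into the tensor algebra of the vector space gl(N).\<close>

definition gl_relations :: "('i::finite gl word \<Rightarrow>\<^sub>0 complex) set" where
  "gl_relations =
     {letter (x + y) - (letter x + letter y) |x y. True}
   \<union> {letter (gl_scale c x) - c *\<^sub>C letter x |c x. True}
   \<union> {letter x * letter y - letter y * letter x - letter (gl_bracket x y) |x y. True}"

quotient_type 'i ugl = "('i::finite gl word) \<Rightarrow>\<^sub>0 complex" /
  "\<lambda>p q. p - q \<in> two_sided_ideal gl_relations"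
  by (rule ideal_equivp)

instantiation ugl :: (finite) complex_algebra_1
begin
lift_definition zero_ugl :: "'a ugl" is 0 .
lift_definition one_ugl :: "'a ugl" is 1 .
lift_definition plus_ugl :: "'a ugl \<Rightarrow> 'a ugl \<Rightarrow> 'a ugl" is "(+)" by (rule ideal_cong_add)
lift_definition uminus_ugl :: "'a ugl \<Rightarrow> 'a ugl" is "uminus" by (rule ideal_cong_uminus)
lift_definition minus_ugl :: "'a ugl \<Rightarrow> 'a ugl \<Rightarrow> 'a ugl" is "(-)" by (rule ideal_cong_diff)
lift_definition times_ugl :: "'a ugl \<Rightarrow> 'a ugl \<Rightarrow> 'a ugl" is "(*)" by (rule ideal_cong_mult)
lift_definition scaleC_ugl :: "complex \<Rightarrow> 'a ugl \<Rightarrow> 'a ugl" is "(*\<^sub>C)" by (rule ideal_cong_scaleC)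
instance
proof
  let ?\<epsilon> = "lin_ext (\<lambda>w. if w = 0 then 1 else 0) :: ('a gl word \<Rightarrow>\<^sub>0 complex) \<Rightarrow> complex"
  have hom: "algebra_hom ?\<epsilon>"
  proof (rule algebra_hom_lin_ext)
    fix v w :: "'a gl word"
    show "(if v + w = 0 then 1 else 0 :: complex) =
            (if v = 0 then 1 else 0) * (if w = 0 then 1 else 0)"
      by (cases v; cases w) (simp add: zero_word_def)
  qed simp
  have letter: "?\<epsilon> (letter x) = 0" for x
    by (simp add: letter_def zero_word_def)
  have "?\<epsilon> x = 0" if "x \<in> two_sided_ideal gl_relations" for x
  proof (rule algebra_hom_ideal[OF hom _ that])
    fix x :: "'a gl word \<Rightarrow>\<^sub>0 complex"
    assume "x \<in> gl_relations"
    thus "?\<epsilon> x = 0"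
      using hom letter unfolding gl_relations_def algebra_hom_def by (auto simp: lin_ext_diff)
  qed
  moreover have "?\<epsilon> (0 - 1) = - 1"
    using hom unfolding algebra_hom_def by (simp add: lin_ext_diff del: diff_0)
  ultimately have "(0 - 1 :: 'a gl word \<Rightarrow>\<^sub>0 complex) \<notin> two_sided_ideal gl_relations"
    by fastforce
  thus "0 \<noteq> (1 :: 'a ugl)" by transfer
qed (transfer; simp add: algebra_simps scaleC_add_right scaleC_add_left ideal_zero)+
end

lift_definition gl_embed :: "'i::finite gl \<Rightarrow> 'i ugl" is letter .

definition E_gl :: "'i::finite \<Rightarrow> 'i \<Rightarrow> 'i ugl" where
  "E_gl i j = gl_embed (elem_matrix i j)"

definition r_gl :: "nat \<Rightarrow> 'i::finite \<Rightarrow> 'i \<Rightarrow> 'i ugl" where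
  "r_gl k a b = (case k of
       0 \<Rightarrow> (if a = b then 1 else 0)
     | Suc l \<Rightarrow> (\<Sum>is | length is = l. prod_list (map2 E_gl (a # is) (is @ [b]))))"


section \<open>The algebra of differential operators\<close>

text \<open>The type \<open>'n\<close> plays the role of the index set 1, ..., n, so n is \<open>CARD('n)\<close>, and
  \<open>'n option\<close> that of 0, ..., n, with \<open>None\<close> for the index 0.  The exponent of a Laurent
  monomial consists of the integer exponent of t0 and the natural exponents of t1, ..., tn.\<close>

type_synonym 'n expo = "int \<times> ('n \<Rightarrow>\<^sub>0 nat)"
type_synonym 'n laurent = "'n expo \<Rightarrow>\<^sub>0 complex"

definition t_inv0 :: "'n laurent" where
  "t_inv0 = Poly_Mapping.single (- 1, 0) 1"

fun t_var :: "'n option \<Rightarrow> 'n laurent" where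
  "t_var None = Poly_Mapping.single (1, 0) 1"
| "t_var (Some i) = Poly_Mapping.single (0, Poly_Mapping.single i 1) 1"

fun pd_monom :: "'n option \<Rightarrow> 'n expo \<Rightarrow> 'n laurent" where
  "pd_monom None (e, \<alpha>) = Poly_Mapping.single (e - 1, \<alpha>) (of_int e)"
| "pd_monom (Some j) (e, \<alpha>) =
     Poly_Mapping.single (e, \<alpha> - Poly_Mapping.single j 1) (of_nat (Poly_Mapping.lookup \<alpha> j))"

definition pd :: "'n option \<Rightarrow> 'n laurent \<Rightarrow> 'n laurent" where
  "pd j = lin_ext (pd_monom j)"

text \<open>As all generators are linear endomorphisms of the Laurent algebra, the subalgebra they
  generate is formed inside the maps on that algebra.\<close>

inductive_set diff_ops :: "('n laurent \<Rightarrow> 'n laurent) set" where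
  diff_ops_ratio: "(\<lambda>p. t_var (Some i) * t_inv0 * p) \<in> diff_ops"
| diff_ops_t0_pd: "(\<lambda>p. t_var None * pd j p) \<in> diff_ops"
| diff_ops_id: "(\<lambda>p. p) \<in> diff_ops"
| diff_ops_add: "D \<in> diff_ops \<Longrightarrow> D' \<in> diff_ops \<Longrightarrow> (\<lambda>p. D p + D' p) \<in> diff_ops"
| diff_ops_scale: "D \<in> diff_ops \<Longrightarrow> (\<lambda>p. c *\<^sub>C D p) \<in> diff_ops"
| diff_ops_comp: "D \<in> diff_ops \<Longrightarrow> D' \<in> diff_ops \<Longrightarrow> (\<lambda>p. D (D' p)) \<in> diff_ops"

lemma diff_ops_zero: "(\<lambda>p. 0) \<in> diff_ops"
  using diff_ops_scale[OF diff_ops_id, of 0] by simp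

lemma diff_ops_uminus: "D \<in> diff_ops \<Longrightarrow> (\<lambda>p. - D p) \<in> diff_ops"
  using diff_ops_scale[of D "- 1"] by simp

lemma diff_ops_diff: "D \<in> diff_ops \<Longrightarrow> D' \<in> diff_ops \<Longrightarrow> (\<lambda>p. D p - D' p) \<in> diff_ops"
  using diff_ops_add[OF _ diff_ops_uminus, of D D'] by simp

lemma diff_ops_linear:
  assumes "D \<in> diff_ops"
  shows "D (p + q) = D p + D q" "D (c *\<^sub>C p) = c *\<^sub>C D p"
  using assms
  by (induction arbitrary: p q c)
     (simp_all add: algebra_simps pd_def lin_ext_add lin_ext_scaleC scaleC_add_right mult.commute)

typedef 'n diffop = "diff_ops :: ('n laurent \<Rightarrow> 'n laurent) set"
  morphisms apply_diffop Abs_diffop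
  using diff_ops_id by blast

setup_lifting type_definition_diffop

instantiation diffop :: (type) complex_algebra_1
begin
lift_definition zero_diffop :: "'a diffop" is "\<lambda>p. 0" by (rule diff_ops_zero)
lift_definition one_diffop :: "'a diffop" is "\<lambda>p. p" by (rule diff_ops_id)
lift_definition plus_diffop :: "'a diffop \<Rightarrow> 'a diffop \<Rightarrow> 'a diffop" is "\<lambda>D D' p. D p + D' p"
  by (rule diff_ops_add)
lift_definition uminus_diffop :: "'a diffop \<Rightarrow> 'a diffop" is "\<lambda>D p. - D p"
  by (rule diff_ops_uminus)
lift_definition minus_diffop :: "'a diffop \<Rightarrow> 'a diffop \<Rightarrow> 'a diffop" is "\<lambda>D D' p. D p - D' p"
  by (rule diff_ops_diff)
lift_definition times_diffop :: "'a diffop \<Rightarrow> 'a diffop \<Rightarrow> 'a diffop" is "\<lambda>D D' p. D (D' p)"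
  by (rule diff_ops_comp)
lift_definition scaleC_diffop :: "complex \<Rightarrow> 'a diffop \<Rightarrow> 'a diffop" is "\<lambda>c D p. c *\<^sub>C D p"
  by (rule diff_ops_scale)
instance
proof
  have "(\<lambda>p. 0) \<noteq> (\<lambda>p. p :: 'a laurent)"
    by (metis one_neq_zero)
  thus "0 \<noteq> (1 :: 'a diffop)" by transfer
qed (transfer; simp add: fun_eq_iff algebra_simps diff_ops_linear scaleC_add_right scaleC_add_left)+
end

lemma t_inv0_t_var: "t_inv0 * t_var None = 1"
  by (simp add: t_inv0_def mult_single zero_prod_def[symmetric])

lemma pd_single [simp]:
  "pd j (Poly_Mapping.single m c) = c *\<^sub>C pd_monom j m"
  by (simp add: pd_def)

lemma pd_add: "pd j (p + q) = pd j p + pd j q"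
  by (simp add: pd_def lin_ext_add)

lemma pd_scaleC: "pd j (c *\<^sub>C p) = c *\<^sub>C pd j p"
  by (simp add: pd_def lin_ext_scaleC)

lemma pd_monom_mult:
  "pd_monom j (m + m') =
     pd_monom j m * Poly_Mapping.single m' 1 + Poly_Mapping.single m 1 * pd_monom j m'"
proof (cases j)
  case None
  thus ?thesis
    by (cases m; cases m') (simp add: mult_single single_add[symmetric] algebra_simps)
next
  case (Some i)
  obtain e \<alpha> e' \<alpha>' where m: "m = (e, \<alpha>)" "m' = (e', \<alpha>')" by (cases m; cases m')
  let ?d = "Poly_Mapping.single i (1::nat)"
  have *: "Poly_Mapping.single (e'', \<beta> - ?d + \<gamma>) (of_nat (Poly_Mapping.lookup \<beta> i) :: complex) =
           Poly_Mapping.single (e'', \<beta> + \<gamma> - ?d) (of_nat (Poly_Mapping.lookup \<beta> i))" for \<beta> \<gamma> e''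
  proof (cases "Poly_Mapping.lookup \<beta> i = 0")
    case False
    hence "\<beta> - ?d + \<gamma> = \<beta> + \<gamma> - ?d"
      by (intro poly_mapping_eqI) (auto simp: lookup_add lookup_minus lookup_single when_def)
    thus ?thesis by simp
  qed simp
  show ?thesis
    using *[of "e + e'" \<alpha> \<alpha>'] *[of "e + e'" \<alpha>' \<alpha>]
    by (simp add: Some m mult_single lookup_add single_add add.commute)
qed

lemma pd_mult: "pd j (p * q) = pd j p * q + p * pd j q"
proof (induction p rule: monoid_algebra_induct)
  case (single k v)
  show ?case
  proof (induction q rule: monoid_algebra_induct)
    case (single k' v')
    have v: "Poly_Mapping.single k v = v *\<^sub>C Poly_Mapping.single k 1"
            "Poly_Mapping.single k' v' = v' *\<^sub>C Poly_Mapping.single k' 1"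
      by (simp_all add: scaleC_complex_def)
    show ?case
      unfolding v by (simp add: pd_scaleC mult_single pd_monom_mult scaleC_add_right mult.commute
          del: scaleC_single)
  qed (simp add: pd_add algebra_simps scaleC_add_right)
qed (simp add: pd_add algebra_simps)

lemma pd_t_var: "pd j (t_var i) = (if i = j then 1 else 0)"
  by (cases i; cases j) (auto simp: zero_prod_def[symmetric] lookup_single)

lift_definition t_ratio :: "'n \<Rightarrow> 'n diffop"
  is "\<lambda>i p. t_var (Some i) * t_inv0 * p"
  by (rule diff_ops_ratio)

lemma diff_ops_t_pd: "(\<lambda>p. t_var a * pd b p) \<in> diff_ops"
proof (cases a)
  case (Some i)
  have "(\<lambda>p. t_var (Some i) * t_inv0 * (t_var None * pd b p)) \<in> diff_ops"
    by (intro diff_ops_comp[OF diff_ops_ratio diff_ops_t0_pd])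
  also have "(\<lambda>p. t_var (Some i) * t_inv0 * (t_var None * pd b p)) =
      (\<lambda>p. t_var (Some i) * (t_inv0 * t_var None) * pd b p)"
    by (simp only: mult.assoc)
  finally show ?thesis by (simp add: t_inv0_t_var Some del: t_var.simps)
qed (simp add: diff_ops_t0_pd del: t_var.simps)

lift_definition t_pd :: "'n option \<Rightarrow> 'n option \<Rightarrow> 'n diffop"
  is "\<lambda>a b p. t_var a * pd b p"
  by (rule diff_ops_t_pd)

lift_definition pd_t :: "'n \<Rightarrow> 'n \<Rightarrow> 'n diffop"
  is "\<lambda>i j p. pd (Some i) (t_var (Some j) * p)"
proof -
  fix i j :: 'n
  have "pd (Some i) (t_var (Some j) * p) =
          (if i = j then 1 else 0) *\<^sub>C p + t_var (Some j) * pd (Some i) p" for p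
    by (auto simp: pd_mult pd_t_var simp del: t_var.simps)
  thus "(\<lambda>p. pd (Some i) (t_var (Some j) * p)) \<in> diff_ops"
    using diff_ops_add[OF diff_ops_scale[OF diff_ops_id, of "if i = j then 1 else 0"]
                          diff_ops_t_pd[of "Some j" "Some i"]]
    by (simp only:)
qed

definition euler :: "'n::finite diffop" where
  "euler = (\<Sum>i\<in>UNIV. t_pd i i)"


section \<open>Tensor products of algebras\<close>

text \<open>The pairs \<open>Pure a b\<close> form the product of the multiplicative monoids of the two algebras,
  written additively so that finitely supported functions on it get their convolution product:
  this makes the free vector space on the symbols \<open>symb a b\<close> an algebra with
  \<open>symb a b * symb c d = symb (a * c) (b * d)\<close>.  The linear span of the bilinearity relations is
  stable under multiplication by these symbols, so it is the ideal generated by the relations.\<close>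

datatype ('a, 'b) pure_tensor = Pure 'a 'b

instantiation pure_tensor :: (monoid_mult, monoid_mult) monoid_add
begin
definition zero_pure_tensor :: "('a, 'b) pure_tensor" where "0 = Pure 1 1"
fun plus_pure_tensor :: "('a, 'b) pure_tensor \<Rightarrow> ('a, 'b) pure_tensor \<Rightarrow> ('a, 'b) pure_tensor" where
  "Pure a b + Pure c d = Pure (a * c) (b * d)"
instance
proof
  fix a b c :: "('a, 'b) pure_tensor"
  show "a + b + c = a + (b + c)" by (cases a; cases b; cases c) (simp add: mult.assoc)
  show "0 + a = a" "a + 0 = a" by (cases a; simp add: zero_pure_tensor_def)+
qed
end

definition symb :: "'a \<Rightarrow> 'b \<Rightarrow> ('a, 'b) pure_tensor \<Rightarrow>\<^sub>0 complex" where
  "symb a b = Poly_Mapping.single (Pure a b) 1"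

definition tensor_relations ::
    "(('a::complex_algebra_1, 'b::complex_algebra_1) pure_tensor \<Rightarrow>\<^sub>0 complex) set" where
  "tensor_relations =
     {symb (a + a') b - (symb a b + symb a' b) |a a' b. True}
   \<union> {symb a (b + b') - (symb a b + symb a b') |a b b'. True}
   \<union> {symb (c *\<^sub>C a) b - c *\<^sub>C symb a b |c a b. True}
   \<union> {symb a (c *\<^sub>C b) - c *\<^sub>C symb a b |c a b. True}"

quotient_type (overloaded) ('a, 'b) tensor =
    "('a::complex_algebra_1, 'b::complex_algebra_1) pure_tensor \<Rightarrow>\<^sub>0 complex" /
  "\<lambda>p q. p - q \<in> two_sided_ideal tensor_relations"
  by (rule ideal_equivp)


lemma exists_linear_functional:
  "\<exists>f :: 'a::complex_algebra_1 \<Rightarrow> complex.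
     (\<forall>x y. f (x + y) = f x + f y) \<and> (\<forall>c x. f (c *\<^sub>C x) = c * f x) \<and> f 1 = 1"
proof -
  interpret vector_space_pair "scaleC :: complex \<Rightarrow> 'a \<Rightarrow> 'a" "(*) :: complex \<Rightarrow> complex \<Rightarrow> complex"
    by unfold_locales (simp_all add: scaleC_add_right scaleC_add_left algebra_simps)
  have "vs1.independent {1}"
    by simp
  from linear_independent_extend[OF this, of "\<lambda>_. 1"]
  obtain f :: "'a \<Rightarrow> complex" where "Vector_Spaces.linear scaleC (*) f" "\<forall>x\<in>{1}. f x = 1" by blast
  hence f: "Vector_Spaces.linear scaleC (*) f" "f 1 = 1" by simp_all
  thus ?thesis
    using linear_add[OF f(1)] linear_scale[OF f(1)] by blast
qed

lemma mult_symb_mult: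
  "Poly_Mapping.single (Pure a b) v * symb x y * Poly_Mapping.single (Pure a' b') v' =
     (v * v') *\<^sub>C symb (a * x * a') (b * y * b')"
  by (simp add: symb_def mult_single scaleC_complex_def)

lemma one_notin_tensor_ideal:
  "(0 - 1 :: ('a::complex_algebra_1, 'b::complex_algebra_1) pure_tensor \<Rightarrow>\<^sub>0 complex)
     \<notin> two_sided_ideal tensor_relations"
proof
  obtain f :: "'a \<Rightarrow> complex" where f: "\<And>x y. f (x + y) = f x + f y"
      "\<And>c x. f (c *\<^sub>C x) = c * f x" "f 1 = 1"
    using exists_linear_functional by metis
  obtain g :: "'b \<Rightarrow> complex" where g: "\<And>x y. g (x + y) = g x + g y"
      "\<And>c x. g (c *\<^sub>C x) = c * g x" "g 1 = 1"
    using exists_linear_functional by metis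
  define \<phi> where "\<phi> = lin_ext (\<lambda>w. case w of Pure a b \<Rightarrow> f a * g b)"
  have add: "\<phi> (p + q) = \<phi> p + \<phi> q" and diff: "\<phi> (p - q) = \<phi> p - \<phi> q"
    and scale: "\<phi> (c *\<^sub>C p) = c * \<phi> p" for p q c
    by (simp_all add: \<phi>_def lin_ext_add lin_ext_diff lin_ext_scaleC scaleC_complex_def)
  have symb: "\<phi> (symb a b) = f a * g b" for a b
    by (simp add: \<phi>_def symb_def)
  have zero: "\<phi> 0 = 0"
    by (simp add: \<phi>_def)
  have rel: "\<phi> (p * x * q) = 0" if "x \<in> tensor_relations" for p q x
  proof (induction p rule: monoid_algebra_induct)
    case (single k v)
    show ?case
    proof (induction q rule: monoid_algebra_induct)
      case (single k' v')
      obtain a b a' b' where k: "k = Pure a b" "k' = Pure a' b'" by (cases k; cases k')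
      note simps = k diff add scale symb f g distrib_left distrib_right left_diff_distrib
        right_diff_distrib mult_symb_mult
      show ?case
        using that unfolding tensor_relations_def by (auto simp: simps)
    qed (simp add: add distrib_left)
  qed (simp add: add distrib_right)
  have "\<forall>p q. \<phi> (p * x * q) = 0" if "x \<in> two_sided_ideal tensor_relations" for x
    using that
  proof induction
    case (ideal_mult x a b)
    thus ?case by (metis mult.assoc)
  qed (simp_all add: zero rel add distrib_left distrib_right)
  moreover assume "0 - 1 \<in> (two_sided_ideal tensor_relations ::
                     (('a, 'b) pure_tensor \<Rightarrow>\<^sub>0 complex) set)"
  ultimately have "\<phi> (1 * (0 - 1) * 1) = 0" by blast
  moreover have "\<phi> 1 = 1"
    using symb[of 1 1] f(3) g(3) by (simp add: symb_def zero_pure_tensor_def[symmetric])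
  ultimately show False by (simp add: diff zero del: diff_0)
qed

instantiation tensor :: (complex_algebra_1, complex_algebra_1) complex_algebra_1
begin
lift_definition zero_tensor :: "('a, 'b) tensor" is 0 .
lift_definition one_tensor :: "('a, 'b) tensor" is 1 .
lift_definition plus_tensor :: "('a, 'b) tensor \<Rightarrow> ('a, 'b) tensor \<Rightarrow> ('a, 'b) tensor"
  is "(+)" by (rule ideal_cong_add)
lift_definition uminus_tensor :: "('a, 'b) tensor \<Rightarrow> ('a, 'b) tensor"
  is "uminus" by (rule ideal_cong_uminus)
lift_definition minus_tensor :: "('a, 'b) tensor \<Rightarrow> ('a, 'b) tensor \<Rightarrow> ('a, 'b) tensor"
  is "(-)" by (rule ideal_cong_diff)
lift_definition times_tensor :: "('a, 'b) tensor \<Rightarrow> ('a, 'b) tensor \<Rightarrow> ('a, 'b) tensor"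
  is "(*)" by (rule ideal_cong_mult)
lift_definition scaleC_tensor :: "complex \<Rightarrow> ('a, 'b) tensor \<Rightarrow> ('a, 'b) tensor"
  is "(*\<^sub>C)" by (rule ideal_cong_scaleC)
instance
proof
  show "0 \<noteq> (1 :: ('a, 'b) tensor)"
    by transfer (rule one_notin_tensor_ideal)
qed (transfer; simp add: algebra_simps scaleC_add_right scaleC_add_left ideal_zero)+
end

lift_definition tens :: "'a::complex_algebra_1 \<Rightarrow> 'b::complex_algebra_1 \<Rightarrow> ('a, 'b) tensor"
  (infixl \<open>\<otimes>\<close> 75) is symb .

lemma tens_add_left: "(a + a') \<otimes> b = a \<otimes> b + a' \<otimes> b"
  by transfer (rule ideal_gen, unfold tensor_relations_def, blast)

lemma tens_add_right: "a \<otimes> (b + b') = a \<otimes> b + a \<otimes> b'"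
  by transfer (rule ideal_gen, unfold tensor_relations_def, blast)

lemma tens_scaleC_left: "(c *\<^sub>C a) \<otimes> b = c *\<^sub>C (a \<otimes> b)"
  by transfer (rule ideal_gen, unfold tensor_relations_def, blast)

lemma tens_scaleC_right: "a \<otimes> (c *\<^sub>C b) = c *\<^sub>C (a \<otimes> b)"
  by transfer (rule ideal_gen, unfold tensor_relations_def, blast)

lemma tens_mult: "(a \<otimes> b) * (c \<otimes> d) = (a * c) \<otimes> (b * d)"
  by transfer (simp add: symb_def mult_single ideal_zero)

lemma tens_one: "1 \<otimes> 1 = 1"
  by transfer (simp add: symb_def zero_pure_tensor_def[symmetric] ideal_zero)


section \<open>The homomorphism from U(gl(n+1))\<close>

definition R1 :: "('n::finite diffop, 'n ugl) tensor" where
  "R1 = (- 1 / of_nat (CARD('n) + 1)) *\<^sub>C (euler \<otimes> 1 + 1 \<otimes> (\<Sum>i\<in>UNIV. E_gl i i))"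

definition R2 :: "('n::finite diffop, 'n ugl) tensor" where
  "R2 = (euler + of_nat CARD('n)) \<otimes> 1"

fun rho_gen :: "'n::finite option \<Rightarrow> 'n option \<Rightarrow> ('n diffop, 'n ugl) tensor" where
  "rho_gen (Some a) (Some b) =
     t_pd (Some a) (Some b) \<otimes> 1 + 1 \<otimes> E_gl a b + (if a = b then R1 else 0)"
| "rho_gen (Some a) None = t_pd (Some a) None \<otimes> 1 - (\<Sum>i\<in>UNIV. t_ratio i \<otimes> E_gl a i)"
| "rho_gen None (Some b) = t_pd None (Some b) \<otimes> 1"
| "rho_gen None None = t_pd None None \<otimes> 1 + R1"

text \<open>Existence and uniqueness: \<open>rho_exists_unique\<close> below.\<close>

definition rho :: "'n::finite option ugl \<Rightarrow> ('n diffop, 'n ugl) tensor" where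
  "rho = (THE h. algebra_hom h \<and> (\<forall>a b. h (E_gl a b) = rho_gen a b))"

definition f_elt :: "nat \<Rightarrow> 'n option \<Rightarrow> 'n::finite \<Rightarrow> ('n diffop, 'n ugl) tensor" where
  "f_elt m a b = (\<Sum>i\<in>UNIV. t_pd a (Some i) \<otimes> r_gl (m - 1) i b)"


section \<open>Existence and uniqueness of the homomorphism\<close>

abbreviation lie :: "'a::ring \<Rightarrow> 'a \<Rightarrow> 'a" where
  "lie x y \<equiv> x * y - y * x"

lemma algebra_homD:
  assumes "algebra_hom h"
  shows "h 1 = 1" "h (x + y) = h x + h y" "h (x * y) = h x * h y" "h (c *\<^sub>C x) = c *\<^sub>C h x"
    "h 0 = 0" "h (- x) = - h x" "h (x - y) = h x - h y"
proof -
  show a: "h 1 = 1" "h (x + y) = h x + h y" "h (x * y) = h x * h y" "h (c *\<^sub>C x) = c *\<^sub>C h x"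
    for x y c using assms unfolding algebra_hom_def by blast+
  show "h 0 = 0" using a(4)[of 0 0] by simp
  show "h (- x) = - h x" for x using a(4)[of "-1" x] by simp
  show "h (x - y) = h x - h y" using a(2)[of "x - y" y] by simp
qed

lemma gl_embed_add: "gl_embed (x + y) = gl_embed x + gl_embed y"
  by transfer (rule ideal_gen, unfold gl_relations_def, blast)

lemma gl_embed_scale: "gl_embed (gl_scale c x) = c *\<^sub>C gl_embed x"
  by transfer (rule ideal_gen, unfold gl_relations_def, blast)

lemma gl_embed_bracket: "gl_embed (gl_bracket x y) = lie (gl_embed x) (gl_embed y)"
proof -
  have "lie (gl_embed x) (gl_embed y) = gl_embed (gl_bracket x y)"
    by transfer (rule ideal_gen, unfold gl_relations_def, blast)
  thus ?thesis ..
qed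

lemma gl_embed_zero: "gl_embed (0 :: 'a::finite gl) = 0"
proof -
  have "gl_scale 0 0 = (0 :: 'a gl)"
    by (simp add: gl_scale_def vec_eq_iff)
  thus ?thesis
    using gl_embed_scale[of 0 "0 :: 'a gl"] by simp
qed

lemma gl_embed_sum: "gl_embed (sum f A) = (\<Sum>x\<in>A. gl_embed (f x))"
  by (induction A rule: infinite_finite_induct) (simp_all add: gl_embed_zero gl_embed_add)

lemma gl_embed_expand: "gl_embed x = (\<Sum>i\<in>UNIV. \<Sum>j\<in>UNIV. (x $ i $ j) *\<^sub>C E_gl i j)"
proof -
  have "x = (\<Sum>i\<in>UNIV. \<Sum>j\<in>UNIV. gl_scale (x $ i $ j) (elem_matrix i j))"
  proof -
    have "(\<Sum>i\<in>UNIV. \<Sum>j\<in>UNIV. if p = i \<and> q = j then x $ i $ j else 0) =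
          (\<Sum>i\<in>UNIV. if p = i then (\<Sum>j\<in>UNIV. if q = j then x $ i $ j else 0) else 0)" for p q
      by (intro sum.cong) auto
    thus ?thesis
      by (simp add: vec_eq_iff gl_scale_def elem_matrix_def if_distrib[of "\<lambda>y. _ * y"] cong: if_cong)
  qed
  hence "gl_embed x = gl_embed (\<Sum>i\<in>UNIV. \<Sum>j\<in>UNIV. gl_scale (x $ i $ j) (elem_matrix i j))"
    by (rule arg_cong)
  thus ?thesis
    by (simp add: gl_embed_sum gl_embed_scale E_gl_def)
qed

lemma lie_E_gl:
  "lie (E_gl i j) (E_gl k l) =
     (if j = k then E_gl i l else 0) - (if l = i then E_gl k j else 0)"
proof -
  have m: "elem_matrix i j ** elem_matrix k l = (if j = k then elem_matrix i l else 0)"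
    for i j k l :: 'a
  proof -
    have "(\<Sum>r\<in>UNIV. (if p = i \<and> r = j then 1 else 0) * (if r = k \<and> q = l then 1 else 0)) =
          (\<Sum>r\<in>UNIV. if r = j then (if j = k \<and> p = i \<and> q = l then 1 else 0 :: complex) else 0)"
      for p q
      by (intro sum.cong) auto
    thus ?thesis
      by (simp add: vec_eq_iff elem_matrix_def matrix_matrix_mult_def)
  qed
  have neg: "gl_embed (- x) = - gl_embed x" for x :: "'a gl"
    using gl_embed_add[of x "- x"] by (simp add: gl_embed_zero eq_neg_iff_add_eq_0 add.commute)
  show ?thesis
    using gl_embed_add[of _ "- _"]
    unfolding E_gl_def gl_embed_bracket[symmetric] gl_bracket_def m
    by (auto simp: gl_embed_zero neg diff_conv_add_uminus gl_embed_add simp del: add_uminus_conv_diff)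
qed

lemma sum_if_eq:
  fixes f :: "'a::finite \<Rightarrow> 'b::comm_monoid_add"
  shows "(\<Sum>x\<in>UNIV. if x = a then f x else 0) = f a" "(\<Sum>x\<in>UNIV. if a = x then f x else 0) = f a"
  by simp_all

lemma ugl_universal:
  fixes e :: "'i::finite \<Rightarrow> 'i \<Rightarrow> 'b::complex_algebra_1"
  assumes rel: "\<And>i j k l. lie (e i j) (e k l) =
      (if j = k then e i l else 0) - (if l = i then e k j else 0)"
  shows "\<exists>!h. algebra_hom h \<and> (\<forall>i j. h (E_gl i j) = e i j)"
proof (rule ex_ex1I)
  define H where "H = (\<lambda>x :: 'i gl. \<Sum>i\<in>UNIV. \<Sum>j\<in>UNIV. (x $ i $ j) *\<^sub>C e i j)"
  define h0 where "h0 = lin_ext (\<lambda>w. case w of Word xs \<Rightarrow> prod_list (map H xs))"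
  have hom: "algebra_hom h0"
    unfolding h0_def
  proof (rule algebra_hom_lin_ext)
    fix v w :: "'i gl word"
    show "(case v + w of Word xs \<Rightarrow> prod_list (map H xs)) =
        (case v of Word xs \<Rightarrow> prod_list (map H xs)) * (case w of Word xs \<Rightarrow> prod_list (map H xs))"
      by (cases v; cases w) simp
  qed (simp add: zero_word_def)
  have letter: "h0 (letter x) = H x" for x
    by (simp add: h0_def letter_def)
  have H_add: "H (x + y) = H x + H y" for x y
    by (simp add: H_def scaleC_add_left sum.distrib)
  have H_scale: "H (gl_scale c x) = c *\<^sub>C H x" for c x
    by (simp add: H_def gl_scale_def scaleC_sum_right)
  have H_bracket: "H (gl_bracket x y) = lie (H x) (H y)" for x y
  proof -
    define M where "M x y = (\<Sum>i\<in>UNIV. \<Sum>j\<in>UNIV. \<Sum>l\<in>UNIV. (x $ i $ l * y $ l $ j) *\<^sub>C e i j)"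
      for x y :: "'i gl"
    have "H (gl_bracket x y) = M x y - M y x"
      by (simp add: H_def gl_bracket_def M_def matrix_matrix_mult_def scaleC_diff_left
            scaleC_sum_left sum_subtractf)
    have sw: "(\<Sum>k\<in>UNIV. \<Sum>l\<in>UNIV. \<Sum>i\<in>UNIV. \<Sum>j\<in>UNIV. F i j k l) =
          (\<Sum>i\<in>UNIV. \<Sum>j\<in>UNIV. \<Sum>k\<in>UNIV. \<Sum>l\<in>UNIV. F i j k l)"
      for F :: "'i \<Rightarrow> 'i \<Rightarrow> 'i \<Rightarrow> 'i \<Rightarrow> 'b"
      using sum.swap[of "\<lambda>kl ij. F (fst ij) (snd ij) (fst kl) (snd kl)" "UNIV \<times> UNIV" "UNIV \<times> UNIV"]
      by (simp add: sum.cartesian_product' del: UNIV_Times_UNIV)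
    have prod: "H x * H y = (\<Sum>i\<in>UNIV. \<Sum>j\<in>UNIV. \<Sum>k\<in>UNIV. \<Sum>l\<in>UNIV.
              (x $ i $ j * y $ k $ l) *\<^sub>C (e i j * e k l))" for x y
      by (subst sw[symmetric])
         (simp add: H_def sum_distrib_left sum_distrib_right mult.commute scaleC_sum_right)
    have "H y * H x = (\<Sum>i\<in>UNIV. \<Sum>j\<in>UNIV. \<Sum>k\<in>UNIV. \<Sum>l\<in>UNIV.
              (x $ i $ j * y $ k $ l) *\<^sub>C (e k l * e i j))"
    proof -
      show ?thesis
        unfolding prod by (subst sw[symmetric]) (simp add: mult.commute)
    qed
    hence "lie (H x) (H y) = (\<Sum>i\<in>UNIV. \<Sum>j\<in>UNIV. \<Sum>k\<in>UNIV. \<Sum>l\<in>UNIV.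
              (x $ i $ j * y $ k $ l) *\<^sub>C (e i j * e k l)) -
          (\<Sum>i\<in>UNIV. \<Sum>j\<in>UNIV. \<Sum>k\<in>UNIV. \<Sum>l\<in>UNIV.
              (x $ i $ j * y $ k $ l) *\<^sub>C (e k l * e i j))"
      by (simp only: prod)
    also have "\<dots> = (\<Sum>i\<in>UNIV. \<Sum>j\<in>UNIV. \<Sum>k\<in>UNIV. \<Sum>l\<in>UNIV.
              (x $ i $ j * y $ k $ l) *\<^sub>C lie (e i j) (e k l))"
      by (simp add: sum_subtractf scaleC_diff_right)
    also have "\<dots> = (\<Sum>i\<in>UNIV. \<Sum>j\<in>UNIV. \<Sum>k\<in>UNIV. \<Sum>l\<in>UNIV.
              if k = j then (x $ i $ j * y $ k $ l) *\<^sub>C e i l else 0)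
           - (\<Sum>i\<in>UNIV. \<Sum>j\<in>UNIV. \<Sum>k\<in>UNIV. \<Sum>l\<in>UNIV.
              if l = i then (x $ i $ j * y $ k $ l) *\<^sub>C e k j else 0)"
      unfolding sum_subtractf[symmetric] rel by (intro sum.cong) (auto simp: scaleC_diff_right)
    also have "(\<Sum>i\<in>UNIV. \<Sum>j\<in>UNIV. \<Sum>k\<in>UNIV. \<Sum>l\<in>UNIV.
              if k = j then (x $ i $ j * y $ k $ l) *\<^sub>C e i l else 0) =
            (\<Sum>i\<in>UNIV. \<Sum>j\<in>UNIV. \<Sum>l\<in>UNIV. \<Sum>k\<in>UNIV.
              if k = j then (x $ i $ j * y $ k $ l) *\<^sub>C e i l else 0)"
      by (intro sum.cong refl sum.swap)
    also have "\<dots> = M x y"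
      unfolding M_def sum_if_eq by (intro sum.cong refl sum.swap)
    also have "(\<Sum>i\<in>UNIV. \<Sum>j\<in>UNIV. \<Sum>k\<in>UNIV. \<Sum>l\<in>UNIV.
              if l = i then (x $ i $ j * y $ k $ l) *\<^sub>C e k j else 0) =
            (\<Sum>i\<in>UNIV. \<Sum>j\<in>UNIV. \<Sum>k\<in>UNIV. (y $ k $ i * x $ i $ j) *\<^sub>C e k j)"
      unfolding sum_if_eq by (simp add: mult.commute)
    also have "\<dots> = (\<Sum>i\<in>UNIV. \<Sum>k\<in>UNIV. \<Sum>j\<in>UNIV. (y $ k $ i * x $ i $ j) *\<^sub>C e k j)"
      by (intro sum.cong refl sum.swap)
    also have "\<dots> = (\<Sum>k\<in>UNIV. \<Sum>i\<in>UNIV. \<Sum>j\<in>UNIV. (y $ k $ i * x $ i $ j) *\<^sub>C e k j)"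
      by (rule sum.swap)
    also have "\<dots> = M y x"
      unfolding M_def by (intro sum.cong refl sum.swap)
    finally show ?thesis
      using \<open>H (gl_bracket x y) = M x y - M y x\<close> by simp
  qed
  have "h0 x = 0" if "x \<in> two_sided_ideal gl_relations" for x
  proof (rule algebra_hom_ideal[OF hom _ that])
    fix x :: "'i gl word \<Rightarrow>\<^sub>0 complex"
    assume "x \<in> gl_relations"
    thus "h0 x = 0"
      unfolding gl_relations_def
      by (auto simp: algebra_homD[OF hom] letter H_add H_scale H_bracket)
  qed
  hence resp: "h0 p = h0 q" if "p - q \<in> two_sided_ideal gl_relations" for p q
    using that algebra_homD(7)[OF hom, of p q] by fastforce
  define h where "h q = h0 (rep_ugl q)" for q
  have h_abs: "h (abs_ugl p) = h0 p" for p
    unfolding h_def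
    by (intro resp Quotient3_rep_abs[OF Quotient3_ugl]) (simp add: ideal_zero)
  have "algebra_hom h"
    unfolding algebra_hom_def
  proof (intro conjI allI)
    show "h 1 = 1"
      by (simp add: one_ugl.abs_eq h_abs algebra_homD[OF hom])
    fix x y :: "'i ugl" and c
    obtain p q where xy: "x = abs_ugl p" "y = abs_ugl q"
      using Quotient3_abs_rep[OF Quotient3_ugl, symmetric] by blast
    show "h (x + y) = h x + h y" "h (x * y) = h x * h y" "h (c *\<^sub>C x) = c *\<^sub>C h x"
      by (simp_all add: xy plus_ugl.abs_eq times_ugl.abs_eq scaleC_ugl.abs_eq h_abs algebra_homD[OF hom])
  qed
  moreover have "h (E_gl i j) = e i j" for i j
  proof -
    have "h (E_gl i j) = H (elem_matrix i j)"
      by (simp add: E_gl_def gl_embed.abs_eq h_abs letter)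
    also have "\<dots> = (\<Sum>p\<in>UNIV. if p = i then (\<Sum>q\<in>UNIV. if q = j then e p q else 0) else 0)"
      unfolding H_def elem_matrix_def
      by (intro sum.cong refl)
         (simp add: if_distrib[of "\<lambda>c. c *\<^sub>C _"] cong: if_cong)
    finally show ?thesis by simp
  qed
  ultimately show "\<exists>h. algebra_hom h \<and> (\<forall>i j. h (E_gl i j) = e i j)" by blast
next
  fix h h' :: "'i ugl \<Rightarrow> 'b"
  assume h: "algebra_hom h \<and> (\<forall>i j. h (E_gl i j) = e i j)"
    and h': "algebra_hom h' \<and> (\<forall>i j. h' (E_gl i j) = e i j)"
  note hom = algebra_homD[OF conjunct1[OF h]] algebra_homD[OF conjunct1[OF h']]
  have sum: "h (sum f A) = (\<Sum>x\<in>A. h (f x))" "h' (sum f A) = (\<Sum>x\<in>A. h' (f x))"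
    for A :: "'i set" and f
    by (induction A rule: infinite_finite_induct) (simp_all add: hom)
  have eq: "h (gl_embed x) = h' (gl_embed x)" for x
    using h h' unfolding gl_embed_expand by (simp add: sum hom)
  have word: "h (abs_ugl (Poly_Mapping.single (Word xs) 1)) =
              h' (abs_ugl (Poly_Mapping.single (Word xs) 1))" for xs
  proof (induction xs)
    case Nil
    thus ?case
      using hom(1) hom(8) by (simp add: zero_word_def[symmetric] one_ugl.abs_eq)
  next
    case (Cons x xs)
    have "abs_ugl (Poly_Mapping.single (Word (x # xs)) 1) =
            gl_embed x * abs_ugl (Poly_Mapping.single (Word xs) 1)"
      by (simp add: gl_embed.abs_eq times_ugl.abs_eq letter_def mult_single)
    thus ?case by (simp add: hom eq Cons)
  qed
  have "h (abs_ugl p) = h' (abs_ugl p)" for p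
  proof (induction p rule: monoid_algebra_induct)
    case (single k v)
    obtain xs where k: "k = Word xs" by (cases k)
    have "abs_ugl (Poly_Mapping.single k v) = v *\<^sub>C abs_ugl (Poly_Mapping.single (Word xs) 1)"
      by (simp add: scaleC_ugl.abs_eq k scaleC_complex_def)
    thus ?case by (simp add: hom word)
  next
    case (add p q)
    thus ?case by (simp add: plus_ugl.abs_eq[symmetric] hom)
  qed
  from this[of "rep_ugl _"] show "h = h'"
    by (simp add: fun_eq_iff Quotient3_abs_rep[OF Quotient3_ugl])
qed


lemma lie_t_pd:
  "lie (t_pd a b) (t_pd c d) = (if b = c then t_pd a d else 0) - (if d = a then t_pd c b else 0)"
proof -
  have comm: "pd b (pd d p) = pd d (pd b p)" for b d and p :: "'a laurent"
  proof (induction p rule: monoid_algebra_induct)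
    case (single m v)
    obtain e \<alpha> where m: "m = (e, \<alpha>)" by (cases m)
    have *: "\<alpha> - Poly_Mapping.single i (1::nat) - Poly_Mapping.single j 1 =
             \<alpha> - Poly_Mapping.single j 1 - Poly_Mapping.single i 1" for i j
      by (intro poly_mapping_eqI) (auto simp: lookup_minus)
    show ?case
    proof (cases b; cases d)
      fix i j assume b: "b = Some i" "d = Some j"
      show ?thesis
      proof (cases "i = j")
        case False
        thus ?thesis
          unfolding b m pd_single pd_monom.simps pd_scaleC scaleC_single scaleC_scaleC *[of i j]
          by (simp add: lookup_minus lookup_single scaleC_complex_def mult_ac)
      qed (simp add: b)
    qed (simp_all add: m scaleC_complex_def mult.assoc mult.commute[of "of_int e"])
  qed (simp add: pd_add)
  show ?thesis
    by transfer
       (auto simp: fun_eq_iff pd_mult pd_t_var algebra_simps comm simp del: t_var.simps)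
qed

lemma t_ratio_comm: "t_ratio i * t_ratio j = t_ratio j * t_ratio i"
  by transfer (simp add: fun_eq_iff mult_ac)

lemma pd_inv0: "pd j t_inv0 = (if j = None then - (t_inv0 * t_inv0) else 0)"
  by (cases j) (simp_all add: t_inv0_def mult_single single_uminus scaleC_complex_def)

definition t_rat :: "'n option \<Rightarrow> 'n diffop" where
  "t_rat a = (case a of None \<Rightarrow> 1 | Some i \<Rightarrow> t_ratio i)"

lemma lie_t_pd_t_ratio:
  "lie (t_pd a b) (t_ratio i) =
     (case b of None \<Rightarrow> - (t_rat a * t_ratio i) | Some j \<Rightarrow> if i = j then t_rat a else 0)"
proof -
  have "apply_diffop (t_rat a) p = t_var a * t_inv0 * p" for p
    by (cases a) (simp_all add: t_rat_def one_diffop.rep_eq t_ratio.rep_eq t_inv0_t_var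
         mult.commute[of _ t_inv0] del: t_var.simps)
  moreover define r where "r = t_rat a"
  ultimately have r: "apply_diffop r = (\<lambda>p. t_var a * t_inv0 * p)" by auto
  show ?thesis
    unfolding r_def[symmetric]
    by (cases b; rule apply_diffop_inject[THEN iffD1])
       (auto simp: fun_eq_iff r times_diffop.rep_eq minus_diffop.rep_eq uminus_diffop.rep_eq
         zero_diffop.rep_eq t_pd.rep_eq t_ratio.rep_eq pd_mult pd_t_var pd_inv0 algebra_simps
         simp del: t_var.simps)
qed

lemma tens_zero_left [simp]: "0 \<otimes> b = 0"
  using tens_scaleC_left[of 0 0 b] by simp

lemma tens_zero_right [simp]: "a \<otimes> 0 = 0"
  using tens_scaleC_right[of a 0 0] by simp

lemma tens_minus_left: "(- a) \<otimes> b = - (a \<otimes> b)"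
  using tens_scaleC_left[of "- 1" a b] by simp

lemma tens_minus_right: "a \<otimes> (- b) = - (a \<otimes> b)"
  using tens_scaleC_right[of a "- 1" b] by simp

lemma tens_diff_left: "(a - a') \<otimes> b = a \<otimes> b - a' \<otimes> b"
  using tens_add_left[of a "- a'" b] by (simp add: tens_minus_left)

lemma tens_diff_right: "a \<otimes> (b - b') = a \<otimes> b - a \<otimes> b'"
  using tens_add_right[of a b "- b'"] by (simp add: tens_minus_right)

lemma tens_sum_left: "sum f A \<otimes> b = (\<Sum>x\<in>A. f x \<otimes> b)"
  by (induction A rule: infinite_finite_induct) (simp_all add: tens_add_left)

lemma tens_sum_right: "a \<otimes> sum f A = (\<Sum>x\<in>A. a \<otimes> f x)"
  by (induction A rule: infinite_finite_induct) (simp_all add: tens_add_right)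

lemmas tens_linear = tens_add_left tens_add_right tens_diff_left tens_diff_right
  tens_minus_left tens_minus_right tens_scaleC_left tens_scaleC_right

lemma lie_tens_commuting:
  assumes "a * c = c * a"
  shows "lie (a \<otimes> b) (c \<otimes> d) = (a * c) \<otimes> lie b d"
  using assms by (simp add: tens_mult tens_diff_right)

lemma lie_tens_commuting':
  assumes "b * d = d * b"
  shows "lie (a \<otimes> b) (c \<otimes> d) = lie a c \<otimes> (b * d)"
  using assms by (simp add: tens_mult tens_diff_left)

lemma lie_sum_left: "lie (sum f A) y = (\<Sum>x\<in>A. lie (f x) y)"
  for y :: "'a::ring"
  by (simp add: sum_distrib_left sum_distrib_right sum_subtractf)

lemma lie_sum_right: "lie x (sum f A) = (\<Sum>y\<in>A. lie x (f y))"
  for x :: "'a::ring"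
  by (simp add: sum_distrib_left sum_distrib_right sum_subtractf)

lemma UNIV_option_sum: "(\<Sum>i\<in>(UNIV :: 'n::finite option set). f i) = f None + (\<Sum>i\<in>UNIV. f (Some i))"
  unfolding UNIV_option_conv by (subst sum.insert) (auto simp: sum.reindex)

lemma euler_commutes_t_pd: "euler * t_pd a b = t_pd a b * euler"
proof -
  have "lie euler (t_pd a b) = (\<Sum>i\<in>UNIV. lie (t_pd i i) (t_pd a b))"
    unfolding euler_def by (rule lie_sum_left)
  also have "\<dots> = 0"
    unfolding lie_t_pd sum_subtractf by simp
  finally show ?thesis by simp
qed

lemma euler_commutes_t_ratio: "euler * t_ratio i = t_ratio i * euler"
proof -
  have "lie euler (t_ratio i) = (\<Sum>j\<in>UNIV. lie (t_pd j j) (t_ratio i))"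
    unfolding euler_def by (rule lie_sum_left)
  also have "\<dots> = 0"
    unfolding lie_t_pd_t_ratio UNIV_option_sum by (simp add: t_rat_def)
  finally show ?thesis by simp
qed

lemma trace_commutes_E_gl: "(\<Sum>i\<in>UNIV. E_gl i i) * E_gl a b = E_gl a b * (\<Sum>i\<in>UNIV. E_gl i i)"
proof -
  have "lie (\<Sum>i\<in>UNIV. E_gl i i) (E_gl a b) = (\<Sum>i\<in>UNIV. lie (E_gl i i) (E_gl a b))"
    by (rule lie_sum_left)
  also have "\<dots> = 0"
    unfolding lie_E_gl sum_subtractf by simp
  finally show ?thesis by simp
qed

lemma R1_commutes_tens:
  assumes "euler * x = x * euler" "(\<Sum>i\<in>UNIV. E_gl i i) * u = u * (\<Sum>i\<in>UNIV. E_gl i i)"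
  shows "R1 * (x \<otimes> u) = (x \<otimes> u) * R1"
  by (simp add: R1_def distrib_left distrib_right tens_mult assms)

definition rho_G :: "'n::finite option \<Rightarrow> 'n option \<Rightarrow> ('n diffop, 'n ugl) tensor" where
  "rho_G a b = (case a of None \<Rightarrow> 0 | Some i \<Rightarrow>
     (case b of None \<Rightarrow> - (\<Sum>j\<in>UNIV. t_ratio j \<otimes> E_gl i j) | Some j \<Rightarrow> 1 \<otimes> E_gl i j))"

definition rho_X :: "'n::finite option \<Rightarrow> 'n \<Rightarrow> ('n diffop, 'n ugl) tensor" where
  "rho_X a c = (\<Sum>i\<in>UNIV. (t_rat a * t_ratio i) \<otimes> E_gl c i)"

lemma rho_gen_altdef:
  "rho_gen a b = t_pd a b \<otimes> 1 + rho_G a b + (if a = b then R1 else 0)"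
  by (cases a; cases b) (simp_all add: rho_G_def)

lemma lie_t_pd_rho_G:
  "lie (t_pd a b \<otimes> 1) (rho_G c d) = (case c of None \<Rightarrow> 0 | Some c' \<Rightarrow> (case d of Some _ \<Rightarrow> 0
     | None \<Rightarrow> (case b of None \<Rightarrow> rho_X a c' | Some j \<Rightarrow> - (t_rat a \<otimes> E_gl c' j))))"
proof (cases c)
  case (Some c')
  show ?thesis
  proof (cases d)
    case None
    have "lie (t_pd a b \<otimes> 1) (rho_G c d) =
            - lie (t_pd a b \<otimes> 1) (\<Sum>j\<in>UNIV. t_ratio j \<otimes> E_gl c' j)"
      by (simp add: rho_G_def Some None)
    also have "\<dots> = - (\<Sum>j\<in>UNIV. lie (t_pd a b) (t_ratio j) \<otimes> E_gl c' j)"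
      unfolding lie_sum_right by (subst lie_tens_commuting') simp_all
    also have "\<dots> = (case b of None \<Rightarrow> rho_X a c' | Some j \<Rightarrow> - (t_rat a \<otimes> E_gl c' j))"
      unfolding lie_t_pd_t_ratio
      by (cases b) (simp_all add: rho_X_def tens_linear sum_negf if_distrib[of "\<lambda>x. x \<otimes> _"] cong: if_cong)
    finally show ?thesis by (simp add: Some None)
  qed (simp add: rho_G_def Some tens_mult)
qed (simp add: rho_G_def)

lemma lie_rho_G_Some_Some:
  "lie (rho_G (Some a) (Some b)) (rho_G (Some c) (Some d)) =
     (if b = c then rho_G (Some a) (Some d) else 0) - (if d = a then rho_G (Some c) (Some b) else 0)"
  unfolding rho_G_def option.case
  by (subst lie_tens_commuting) (simp_all add: lie_E_gl tens_linear)

lemma lie_rho_G_Some_None: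
  "lie (rho_G (Some a) (Some b)) (rho_G (Some c) None) =
     (if b = c then rho_G (Some a) None else 0) + t_ratio a \<otimes> E_gl c b"
proof -
  have "lie (rho_G (Some a) (Some b)) (rho_G (Some c) None) =
          - lie (1 \<otimes> E_gl a b) (\<Sum>j\<in>UNIV. t_ratio j \<otimes> E_gl c j)"
    by (simp add: rho_G_def)
  also have "\<dots> = - (\<Sum>j\<in>UNIV. t_ratio j \<otimes> lie (E_gl a b) (E_gl c j))"
    unfolding lie_sum_right by (subst lie_tens_commuting) simp_all
  also have "\<dots> = - (\<Sum>j\<in>UNIV. (if b = c then t_ratio j \<otimes> E_gl a j else 0)
                                - (if j = a then t_ratio j \<otimes> E_gl c b else 0))"
    unfolding lie_E_gl tens_diff_right by (intro arg_cong[where f = uminus] sum.cong) auto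
  also have "\<dots> = (if b = c then rho_G (Some a) None else 0) + t_ratio a \<otimes> E_gl c b"
    by (simp add: sum_subtractf rho_G_def)
  finally show ?thesis .
qed

lemma lie_rho_G_None_None:
  "lie (rho_G (Some a) None) (rho_G (Some c) None) = rho_X (Some c) a - rho_X (Some a) c"
proof -
  have "lie (rho_G (Some a) None) (rho_G (Some c) None) =
          lie (\<Sum>i\<in>UNIV. t_ratio i \<otimes> E_gl a i) (\<Sum>j\<in>UNIV. t_ratio j \<otimes> E_gl c j)"
    by (simp add: rho_G_def)
  also have "\<dots> = (\<Sum>i\<in>UNIV. \<Sum>j\<in>UNIV. (t_ratio i * t_ratio j) \<otimes> lie (E_gl a i) (E_gl c j))"
    unfolding lie_sum_left unfolding lie_sum_right
    by (intro sum.cong refl lie_tens_commuting t_ratio_comm)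
  also have "\<dots> = (\<Sum>i\<in>UNIV. \<Sum>j\<in>UNIV. (if i = c then (t_ratio i * t_ratio j) \<otimes> E_gl a j else 0)
                   - (if j = a then (t_ratio i * t_ratio j) \<otimes> E_gl c i else 0))"
    unfolding lie_E_gl tens_diff_right by (intro sum.cong refl) auto
  also have "\<dots> = (\<Sum>j\<in>UNIV. \<Sum>i\<in>UNIV. if i = c then (t_ratio i * t_ratio j) \<otimes> E_gl a j else 0)
                   - (\<Sum>i\<in>UNIV. \<Sum>j\<in>UNIV. if j = a then (t_ratio i * t_ratio j) \<otimes> E_gl c i else 0)"
    unfolding sum_subtractf by (subst (1) sum.swap) (rule refl)
  also have "\<dots> = rho_X (Some c) a - rho_X (Some a) c"
    by (simp add: rho_X_def t_rat_def t_ratio_comm)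
  finally show ?thesis .
qed

lemma rho_G_None [simp]: "rho_G None b = 0"
  by (simp add: rho_G_def)

lemma R1_commutes_rho_gen: "R1 * rho_gen a b = rho_gen a b * R1"
proof -
  have "R1 * rho_G a b = rho_G a b * R1"
  proof -
    have "R1 * (t_ratio j \<otimes> E_gl i j) = (t_ratio j \<otimes> E_gl i j) * R1"
      "R1 * (1 \<otimes> E_gl i j) = (1 \<otimes> E_gl i j) * R1" for i j :: 'a
      by (intro R1_commutes_tens euler_commutes_t_ratio trace_commutes_E_gl; simp)+
    thus ?thesis
      by (auto simp: rho_G_def sum_distrib_left sum_distrib_right split: option.split)
  qed
  moreover have "R1 * (t_pd a b \<otimes> 1) = (t_pd a b \<otimes> 1) * R1"
    by (intro R1_commutes_tens euler_commutes_t_pd) simp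
  ultimately show ?thesis
    by (simp add: rho_gen_altdef distrib_left distrib_right)
qed

lemma lie_rho_gen:
  "lie (rho_gen a b) (rho_gen c d) =
     (if b = c then rho_gen a d else 0) - (if d = a then rho_gen c b else 0)"
proof -
  define e where "e a b = t_pd a b \<otimes> 1 + rho_G a b" for a b :: "'a option"
  have rg: "rho_gen a b = e a b + (if a = b then R1 else 0)" for a b
    by (simp add: rho_gen_altdef e_def)
  have R1: "R1 * e a b = e a b * R1" for a b
    using R1_commutes_rho_gen[of a b] by (simp add: rg distrib_left distrib_right split: if_splits)
  have arith: "x + y - z + w = x + (y - z + w)" for x y z w :: "('a diffop, 'a ugl) tensor"
    by simp
  have "lie (rho_gen a b) (rho_gen c d) = lie (e a b) (e c d)"
    by (simp add: rg distrib_left distrib_right R1)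
  also have "lie (e a b) (e c d) =
      lie (t_pd a b \<otimes> 1) (t_pd c d \<otimes> 1) + lie (t_pd a b \<otimes> 1) (rho_G c d)
      - lie (t_pd c d \<otimes> 1) (rho_G a b) + lie (rho_G a b) (rho_G c d)"
    by (simp add: e_def algebra_simps)
  also have "\<dots> = lie (t_pd a b \<otimes> 1) (t_pd c d \<otimes> 1) + (lie (t_pd a b \<otimes> 1) (rho_G c d)
      - lie (t_pd c d \<otimes> 1) (rho_G a b) + lie (rho_G a b) (rho_G c d))"
    by (rule arith)
  also have "lie (t_pd a b \<otimes> 1) (t_pd c d \<otimes> 1) =
      ((if b = c then t_pd a d else 0) - (if d = a then t_pd c b else 0)) \<otimes> 1"
    by (subst lie_tens_commuting') (simp_all add: lie_t_pd)
  also have "lie (t_pd a b \<otimes> 1) (rho_G c d) - lie (t_pd c d \<otimes> 1) (rho_G a b)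
        + lie (rho_G a b) (rho_G c d) =
      (if b = c then rho_G a d else 0) - (if d = a then rho_G c b else 0)"
  proof -
    have swap: "lie (rho_G a b) (rho_G c d) = - lie (rho_G c d) (rho_G a b)" by simp
    have one: "rho_G (Some i) (Some j) = 1 \<otimes> E_gl i j" for i j :: 'a
      by (simp add: rho_G_def)
    have rat: "t_rat None = 1" "t_rat (Some i) = t_ratio i" for i :: 'a
      by (simp_all add: t_rat_def)
    have X: "rho_X None i = - rho_G (Some i) None" for i :: 'a
      by (simp add: rho_X_def rho_G_def t_rat_def)
    have SN: "lie (rho_G (Some c') None) (rho_G (Some a') (Some b')) =
        - (if b' = c' then rho_G (Some a') None else 0) - t_ratio a' \<otimes> E_gl c' b'" for a' b' c' :: 'a
      using lie_rho_G_Some_None[of a' b' c'] by (simp add: algebra_simps)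
    show ?thesis
      unfolding lie_t_pd_rho_G
      by (cases a; cases b; cases c; cases d)
         (simp_all only: lie_rho_G_Some_Some lie_rho_G_Some_None lie_rho_G_None_None SN rho_G_None
            option.case option.inject option.distinct if_False X rat mult_zero_left mult_zero_right
            diff_zero, auto simp: one)
  qed
  finally show ?thesis
    by (auto simp: rho_gen_altdef tens_linear)
qed

theorem rho_exists_unique: "\<exists>!h. algebra_hom h \<and> (\<forall>a b. h (E_gl a b) = rho_gen a b)"
  by (rule ugl_universal[OF lie_rho_gen])

lemma rho_hom: "algebra_hom rho" and rho_E_gl: "rho (E_gl a b) = rho_gen a b"
  using theI'[OF rho_exists_unique] unfolding rho_def by blast+

end

theory Submission
  imports Defs
begin

text \<open>
  Write \<open>M\<close> for the matrix with entries \<open>rho (E_gl a b)\<close>.  Since \<open>r_gl k a b\<close> is the entry of the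
  \<open>k\<close>-th power of the matrix of generators and \<open>rho\<close> is multiplicative, the theorem computes the
  powers of \<open>M\<close>.  The diagonal term of \<open>M\<close> is central: \<open>M = R1 I + N\<close> with \<open>N = rho_shift\<close>, so the
  binomial theorem (\<open>mat_pow_add_central\<close>) accounts for all the factors \<open>(k choose g) R1^g\<close>, and
  it remains to find the powers of \<open>N\<close>.

  The matrix \<open>N\<close> is a rank one part plus a copy of the generators of \<open>gl(n)\<close>.  The column
  \<open>\<tau> = ratio_col\<close> with entries \<open>t_a / t_0\<close> satisfies \<open>N \<tau> = \<tau> R2\<close> (\<open>rho_shift_ratio_col\<close>): the part \<open>rho_G\<close>
  kills \<open>\<tau>\<close>, and the rank one part \<open>t_a \<partial>_b\<close> acts by
  \<open>\<Sum>_b t_a \<partial>_b t_b / t_0 = (t_a / t_0) (\<E> + n)\<close>.  Modulo \<open>\<tau>\<close>, \<open>N\<close> acts on columns with vanishing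
  zeroth entry as the matrix of generators of \<open>gl(n)\<close>.  Hence the columns
  \<open>\<tau> X + w\<close> with \<open>w\<close> supported on \<open>1, ..., n\<close> are stable under \<open>N\<close>, by the rule
  \<open>X \<mapsto> R2 X + \<Sum>_i t_0 \<partial>_i w_i\<close>, \<open>w \<mapsto> E w\<close> (\<open>rho_shift_step\<close>).  Iterating from a unit column
  \<open>e_b\<close>, \<open>b > 0\<close>, gives \<open>w = r_k(-, b)\<close> and the Horner sum of the \<open>f_m(0, b)\<close> in \<open>X\<close>; iterating from
  \<open>e_0 = \<tau> - (\<tau> restricted to 1, ..., n)\<close> gives the other two formulas.
\<close>

section \<open>Powers of matrices over a noncommutative ring\<close>

fun mat_pow :: "('i::finite \<Rightarrow> 'i \<Rightarrow> 'a::ring_1) \<Rightarrow> nat \<Rightarrow> 'i \<Rightarrow> 'i \<Rightarrow> 'a" where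
  "mat_pow A 0 a b = (if a = b then 1 else 0)"
| "mat_pow A (Suc k) a b = (\<Sum>c\<in>UNIV. A a c * mat_pow A k c b)"

lemma mult_binomial_term:
  fixes x y w :: "'a::ring_1"
  assumes "y * x = x * y"
  shows "x * (of_nat m * y ^ g * w) = of_nat m * y ^ g * (x * w)"
proof -
  have "x * (of_nat m * y ^ g * w) = (x * of_nat m) * y ^ g * w"
    by (simp only: mult.assoc)
  also have "\<dots> = of_nat m * (x * y ^ g) * w"
    by (simp only: mult_of_nat_commute[symmetric] mult.assoc)
  also have "x * y ^ g = y ^ g * x"
    by (rule power_commuting_commutes[OF assms, symmetric])
  finally show ?thesis by (simp only: mult.assoc)
qed

lemma binomial_sum_step:
  fixes z :: "'a::ring_1"
  shows "(\<Sum>g=0..Suc k. of_nat (Suc k choose g) * z ^ g * X (Suc k - g)) =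
     z * (\<Sum>g=0..k. of_nat (k choose g) * z ^ g * X (k - g)) +
     (\<Sum>g=0..k. of_nat (k choose g) * z ^ g * X (Suc (k - g)))"
proof -
  have comm: "z * (of_nat m * z ^ g * x) = of_nat m * z ^ Suc g * x" for m g x
    by (subst mult_binomial_term[OF refl]) (simp only: power_Suc2 mult.assoc)
  have "(\<Sum>g=0..k. of_nat (k choose g) * z ^ g * X (Suc (k - g))) =
          (\<Sum>g=0..Suc k. of_nat (k choose g) * z ^ g * X (Suc k - g))"
    by (simp add: Suc_diff_le binomial_eq_0)
  also have "\<dots> = X (Suc k) + (\<Sum>g=0..k. of_nat (k choose Suc g) * z ^ Suc g * X (k - g))"
    by (subst sum.atLeast0_atMost_Suc_shift) simp
  finally show ?thesis
    by (subst sum.atLeast0_atMost_Suc_shift)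
       (simp add: sum_distrib_left comm distrib_right sum.distrib del: power_Suc)
qed

text \<open>The binomial theorem for \<open>(A + z I)^k\<close>, valid because \<open>z I\<close> commutes with \<open>A\<close> even though the
  entries of \<open>A\<close> need not commute with each other.\<close>

lemma mat_pow_add_central:
  fixes z :: "'a::ring_1"
  assumes "\<And>a b. z * A a b = A a b * z"
  shows "mat_pow (\<lambda>a b. A a b + (if a = b then z else 0)) k a b =
           (\<Sum>g=0..k. of_nat (k choose g) * z ^ g * mat_pow A (k - g) a b)"
proof (induction k arbitrary: a)
  case (Suc k)
  let ?S = "\<lambda>c. \<Sum>g=0..k. of_nat (k choose g) * z ^ g * mat_pow A (k - g) c b"
  have comm: "A a c * (of_nat m * z ^ g * x) = of_nat m * z ^ g * (A a c * x)" for c m g x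
    by (rule mult_binomial_term[OF assms])
  have "mat_pow (\<lambda>a b. A a b + (if a = b then z else 0)) (Suc k) a b =
          (\<Sum>c\<in>UNIV. A a c * ?S c) + (\<Sum>c\<in>UNIV. if a = c then z * ?S c else 0)"
    unfolding mat_pow.simps Suc sum.distrib[symmetric]
    by (intro sum.cong) (auto simp: distrib_right)
  also have "(\<Sum>c\<in>UNIV. A a c * ?S c) =
      (\<Sum>g=0..k. of_nat (k choose g) * z ^ g * mat_pow A (Suc (k - g)) a b)"
    by (simp add: sum_distrib_left comm) (rule sum.swap)
  finally show ?case
    unfolding binomial_sum_step[of k z "\<lambda>j. mat_pow A j a b"] by (simp add: add.commute)
qed simp

lemma r_gl_0: "r_gl 0 a b = (if a = b then 1 else 0)"
  by (simp add: r_gl_def)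

lemma r_gl_Suc: "r_gl (Suc k) a b = (\<Sum>c\<in>UNIV. E_gl a c * r_gl k c b)"
proof (cases k)
  case 0
  thus ?thesis by (simp add: r_gl_def if_distrib[of "\<lambda>x. _ * x"] cong: if_cong)
next
  case (Suc l)
  have "{is. length is = Suc l} = (\<lambda>(c, is). c # is) ` (UNIV \<times> {is :: 'a list. length is = l})"
    by (auto simp: length_Suc_conv image_iff)
  moreover have "inj_on (\<lambda>(c, is). c # is) (UNIV \<times> {is :: 'a list. length is = l})"
    by (auto simp: inj_on_def)
  ultimately show ?thesis
    by (simp add: Suc r_gl_def sum.reindex sum_distrib_left split_def sum.cartesian_product' o_def)
qed

lemma algebra_hom_sum:
  assumes "algebra_hom h"
  shows "h (sum f A) = (\<Sum>x\<in>A. h (f x))"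
  by (induction A rule: infinite_finite_induct) (simp_all add: algebra_homD[OF assms])

lemma rho_r_gl: "rho (r_gl k a b) = mat_pow rho_gen k a b"
  by (induction k arbitrary: a)
     (simp_all add: r_gl_0 r_gl_Suc algebra_hom_sum algebra_homD rho_hom rho_E_gl)

lemma r_gl_commutes:
  assumes "\<And>a b. z * E_gl a b = E_gl a b * z"
  shows "z * r_gl k a b = r_gl k a b * z"
proof (induction k arbitrary: a)
  case (Suc k)
  have "z * (E_gl a c * r_gl k c b) = E_gl a c * r_gl k c b * z" for c
    by (metis Suc assms mult.assoc)
  thus ?case by (simp add: r_gl_Suc sum_distrib_left sum_distrib_right)
qed (simp add: r_gl_0)

section \<open>Relations between the differential operators\<close>

lemma t_rat_simps [simp]: "t_rat None = 1" "t_rat (Some i) = t_ratio i"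
  by (simp_all add: t_rat_def)

text \<open>The matrix \<open>t_pd\<close> has rank one; pulling out its left factor reduces the identities below to
  commutators of single operators.\<close>

lemma t_rat_mult_t_pd_None: "t_rat a * t_pd None b = t_pd a b"
proof (cases a)
  case (Some i)
  have "t_var (Some i) * t_inv0 * (t_var None * q) = t_var (Some i) * (t_inv0 * t_var None) * q"
    for q :: "'a laurent"
    by (simp only: mult.assoc)
  hence "t_var (Some i) * t_inv0 * (t_var None * q) = t_var (Some i) * q" for q :: "'a laurent"
    by (simp add: t_inv0_t_var del: t_var.simps)
  thus ?thesis
    unfolding Some t_rat_simps
    by (intro apply_diffop_inject[THEN iffD1])
       (simp add: fun_eq_iff times_diffop.rep_eq t_ratio.rep_eq t_pd.rep_eq del: t_var.simps)
qed simp

lemma t_rat_comm: "t_rat a * t_rat b = t_rat b * t_rat a"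
  by (cases a; cases b) (simp_all add: t_ratio_comm)

lemma t_rat_t_pd_swap: "t_rat a * t_pd b c = t_rat b * t_pd a c"
proof -
  have "t_rat a * t_pd b c = t_rat a * t_rat b * t_pd None c"
    by (simp only: mult.assoc t_rat_mult_t_pd_None)
  also have "\<dots> = t_rat b * t_pd a c"
    by (simp only: t_rat_comm[of a b] mult.assoc t_rat_mult_t_pd_None)
  finally show ?thesis .
qed

lemma euler_commutes_t_rat: "euler * t_rat a = t_rat a * euler"
  by (cases a) (simp_all add: euler_commutes_t_ratio)

lemma pd_t_eq: "pd_t i j = t_pd (Some j) (Some i) + (if i = j then 1 else 0)"
  by (intro apply_diffop_inject[THEN iffD1])
     (auto simp: fun_eq_iff pd_t.rep_eq t_pd.rep_eq plus_diffop.rep_eq one_diffop.rep_eq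
        zero_diffop.rep_eq pd_mult pd_t_var add.commute simp del: t_var.simps)

lemma t_pd_mult_t_ratio: "t_pd a (Some i) * t_ratio j = t_rat a * pd_t i j"
proof -
  have "t_pd a (Some i) * t_ratio j = t_ratio j * t_pd a (Some i) + lie (t_pd a (Some i)) (t_ratio j)"
    by simp
  also have "\<dots> = t_rat a * pd_t i j"
    using t_rat_t_pd_swap[of "Some j" a "Some i"]
    unfolding lie_t_pd_t_ratio by (auto simp: pd_t_eq distrib_left)
  finally show ?thesis .
qed

text \<open>The summand for index 0 is \<open>t_a \<partial>_0\<close> because \<open>t_rat None = 1\<close>; only the other \<open>n\<close> summands
  produce a commutator, hence \<open>n\<close> rather than \<open>n + 1\<close>.\<close>

lemma sum_t_pd_t_rat:
  "(\<Sum>c\<in>UNIV. t_pd a c * t_rat c) = t_rat a * (euler + of_nat CARD('n))" for a :: "'n::finite option"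
proof -
  have "(\<Sum>c\<in>UNIV. t_pd a c * t_rat c) = t_pd a None + (\<Sum>i\<in>UNIV. t_rat a * pd_t i i)"
    by (simp add: UNIV_option_sum t_pd_mult_t_ratio)
  also have "\<dots> = t_rat a * (t_pd None None + (\<Sum>i\<in>UNIV. pd_t i i))"
    by (simp add: distrib_left sum_distrib_left t_rat_mult_t_pd_None)
  also have "t_pd None None + (\<Sum>i\<in>UNIV. pd_t i i) = euler + (of_nat CARD('n) :: 'n diffop)"
    by (simp add: euler_def UNIV_option_sum pd_t_eq sum.distrib add.assoc)
  finally show ?thesis .
qed

section \<open>The shifted image of the generating matrix\<close>

definition rho_shift :: "'n::finite option \<Rightarrow> 'n option \<Rightarrow> ('n diffop, 'n ugl) tensor" where
  "rho_shift a b = t_pd a b \<otimes> 1 + rho_G a b"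

definition ratio_col :: "'n::finite option \<Rightarrow> ('n diffop, 'n ugl) tensor" where
  "ratio_col a = t_rat a \<otimes> 1"

definition lift_col :: "('n \<Rightarrow> 'a::zero) \<Rightarrow> 'n option \<Rightarrow> 'a" where
  "lift_col w a = (case a of None \<Rightarrow> 0 | Some i \<Rightarrow> w i)"

lemma lift_col_simps [simp]: "lift_col w None = 0" "lift_col w (Some i) = w i"
  by (simp_all add: lift_col_def)

lemma rho_gen_eq_shift: "rho_gen = (\<lambda>a b. rho_shift a b + (if a = b then R1 else 0))"
  by (intro ext) (simp add: rho_gen_altdef rho_shift_def)

lemma R1_commutes_rho_shift: "R1 * rho_shift a b = rho_shift a b * R1"
  using R1_commutes_rho_gen[of a b]
  by (simp add: rho_gen_eq_shift distrib_left distrib_right split: if_splits)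

lemma R1_commutes_tens_r_gl:
  assumes "euler * x = x * euler"
  shows "R1 * (x \<otimes> r_gl k a b) = (x \<otimes> r_gl k a b) * R1"
  by (intro R1_commutes_tens assms r_gl_commutes trace_commutes_E_gl)

lemma R2_commutes_tens:
  assumes "euler * x = x * euler"
  shows "R2 * (x \<otimes> u) = (x \<otimes> u) * R2"
  by (simp add: R2_def tens_mult distrib_left distrib_right assms mult_of_nat_commute)

lemma R1_commutes_ratio_col: "R1 * ratio_col a = ratio_col a * R1"
  unfolding ratio_col_def by (intro R1_commutes_tens euler_commutes_t_rat) simp

lemma R2_commutes_ratio_col: "R2 * ratio_col a = ratio_col a * R2"
  unfolding ratio_col_def by (intro R2_commutes_tens euler_commutes_t_rat)

lemma ratio_col_mult_tens: "ratio_col a * (x \<otimes> u) = (t_rat a * x) \<otimes> u"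
  by (simp add: ratio_col_def tens_mult)

lemma rho_G_ratio_col: "(\<Sum>c\<in>UNIV. rho_G a c * ratio_col c) = 0"
  by (cases a) (simp_all add: UNIV_option_sum rho_G_def ratio_col_def tens_mult tens_one sum_distrib_right)

text \<open>The eigenvector that drives the computation.  The eigenvalue acts on the right, but commutes
  with all the operators involved.\<close>

lemma rho_shift_ratio_col: "(\<Sum>c\<in>UNIV. rho_shift a c * ratio_col c) = ratio_col a * R2"
proof -
  have "(\<Sum>c\<in>UNIV. rho_shift a c * ratio_col c) = (\<Sum>c\<in>UNIV. t_pd a c * t_rat c) \<otimes> 1"
    by (simp add: rho_shift_def distrib_right sum.distrib rho_G_ratio_col)
       (simp add: ratio_col_def tens_mult tens_sum_left)
  thus ?thesis by (simp add: sum_t_pd_t_rat ratio_col_def R2_def tens_mult)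
qed

text \<open>On a column supported on \<open>1, ..., n\<close>, \<open>N\<close> acts as the matrix of generators of \<open>gl(n)\<close> up to a
  multiple of the eigenvector, because the row \<open>rho_G None\<close> vanishes and the rows of \<open>t_pd\<close> are
  multiples \<open>t_a / t_0\<close> of the row with index 0.\<close>

lemma rho_shift_step:
  "(\<Sum>c\<in>UNIV. rho_shift a c * (ratio_col c * X + lift_col w c)) =
     ratio_col a * (R2 * X + (\<Sum>i\<in>UNIV. (t_pd None (Some i) \<otimes> 1) * w i))
     + lift_col (\<lambda>j. \<Sum>i\<in>UNIV. (1 \<otimes> E_gl j i) * w i) a"
proof -
  have "(\<Sum>c\<in>UNIV. rho_shift a c * (ratio_col c * X + lift_col w c)) =
      (\<Sum>c\<in>UNIV. rho_shift a c * ratio_col c) * X + (\<Sum>i\<in>UNIV. rho_shift a (Some i) * w i)"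
    by (simp add: distrib_left sum.distrib sum_distrib_right mult.assoc UNIV_option_sum distrib_right add.assoc)
  also have "(\<Sum>i\<in>UNIV. rho_shift a (Some i) * w i) =
      (\<Sum>i\<in>UNIV. (t_pd a (Some i) \<otimes> 1) * w i) + (\<Sum>i\<in>UNIV. rho_G a (Some i) * w i)"
    by (simp add: rho_shift_def distrib_right sum.distrib)
  also have "(\<Sum>i\<in>UNIV. rho_G a (Some i) * w i) = lift_col (\<lambda>j. \<Sum>i\<in>UNIV. (1 \<otimes> E_gl j i) * w i) a"
    by (cases a) (simp_all add: rho_G_def)
  also have "(\<Sum>i\<in>UNIV. (t_pd a (Some i) \<otimes> 1) * w i) =
      ratio_col a * (\<Sum>i\<in>UNIV. (t_pd None (Some i) \<otimes> 1) * w i)"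
    by (simp add: sum_distrib_left mult.assoc[symmetric] ratio_col_mult_tens t_rat_mult_t_pd_None)
  finally show ?thesis
    by (simp add: rho_shift_ratio_col distrib_left mult.assoc add.assoc)
qed

section \<open>Powers of the shifted matrix\<close>

definition pd_t_r :: "nat \<Rightarrow> ('n::finite diffop, 'n ugl) tensor" where
  "pd_t_r l = (\<Sum>i\<in>UNIV. \<Sum>j\<in>UNIV. pd_t i j \<otimes> r_gl l i j)"

lemma tens_E_gl_mult_r_gl:
  "(\<Sum>i\<in>UNIV. (1 \<otimes> E_gl a i) * (x \<otimes> r_gl k i b)) = x \<otimes> r_gl (Suc k) a b"
  by (simp add: r_gl_Suc tens_mult tens_sum_right)

lemma f_elt_ratio_col: "f_elt m a b = ratio_col a * f_elt m None b"
  by (simp add: f_elt_def sum_distrib_left ratio_col_mult_tens t_rat_mult_t_pd_None)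

lemma horner_sum_Suc:
  fixes z :: "'a::ring_1"
  assumes "l \<le> Suc k"
  shows "(\<Sum>m=l..Suc k. z ^ (Suc k - m) * x m) = z * (\<Sum>m=l..k. z ^ (k - m) * x m) + x (Suc k)"
  using assms by (simp add: sum_distrib_left Suc_diff_le mult.assoc)

lemma mat_pow_rho_shift_Some:
  "mat_pow rho_shift k a (Some b) =
     ratio_col a * (\<Sum>m=1..k. R2 ^ (k - m) * f_elt m None b) + lift_col (\<lambda>c. 1 \<otimes> r_gl k c b) a"
proof (induction k arbitrary: a)
  case 0
  show ?case by (cases a) (auto simp: r_gl_0 tens_one)
next
  case (Suc k)
  have "(\<Sum>i\<in>UNIV. (t_pd None (Some i) \<otimes> 1) * (1 \<otimes> r_gl k i b)) = f_elt (Suc k) None b"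
    by (simp add: f_elt_def tens_mult)
  thus ?case
    unfolding mat_pow.simps Suc rho_shift_step tens_E_gl_mult_r_gl
    by (simp only: horner_sum_Suc)
qed

text \<open>The unit column with index 0 is \<open>\<tau>\<close> minus its restriction to \<open>1, ..., n\<close>.  Thus
  \<open>rho_shift_step\<close> starts from \<open>X = 1\<close> and \<open>w_c = - (t_c / t_0) \<otimes> 1\<close>, and each step adds
  \<open>- \<Sum> \<partial>_i t_j \<otimes> r_k(i, j)\<close> to \<open>R2 X\<close>, since \<open>t_0 \<partial>_i (t_j / t_0) = \<partial>_i t_j\<close>.\<close>

lemma mat_pow_rho_shift_None:
  "mat_pow rho_shift k a None =
     ratio_col a * (R2 ^ k - (\<Sum>m=1..k. R2 ^ (k - m) * pd_t_r (m - 1)))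
     - lift_col (\<lambda>c. \<Sum>j\<in>UNIV. t_ratio j \<otimes> r_gl k c j) a"
proof (induction k arbitrary: a)
  case 0
  have "(\<Sum>j\<in>UNIV. t_ratio j \<otimes> (if i = j then 1 else 0)) = t_ratio i \<otimes> (1 :: 'a ugl)" for i :: 'a
    by (simp add: if_distrib[of "\<lambda>x. _ \<otimes> x"] cong: if_cong)
  thus ?case by (cases a) (auto simp: r_gl_0 ratio_col_def tens_one)
next
  case (Suc k)
  let ?w = "\<lambda>c. - (\<Sum>j\<in>UNIV. t_ratio j \<otimes> r_gl k c j)"
  have neg: "lift_col ?w c = - lift_col (\<lambda>c. \<Sum>j\<in>UNIV. t_ratio j \<otimes> r_gl k c j) c" for c
    by (cases c) simp_all
  let ?X = "\<lambda>k. R2 ^ k - (\<Sum>m=1..k. R2 ^ (k - m) * pd_t_r (m - 1) :: ('a diffop, 'a ugl) tensor)"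
  have row: "(\<Sum>i\<in>UNIV. (t_pd None (Some i) \<otimes> 1) * ?w i) = - pd_t_r k"
    by (simp add: pd_t_r_def sum_distrib_left sum_negf tens_mult t_pd_mult_t_ratio)
  have col: "(\<Sum>i\<in>UNIV. (1 \<otimes> E_gl c i) * ?w i) = - (\<Sum>j\<in>UNIV. t_ratio j \<otimes> r_gl (Suc k) c j)"
    for c
    by (simp add: sum_distrib_left sum_negf tens_E_gl_mult_r_gl[symmetric]) (rule sum.swap)
  have X: "R2 * ?X k + - pd_t_r k = ?X (Suc k)"
    using horner_sum_Suc[of 1 k R2 "\<lambda>m. pd_t_r (m - 1) :: ('a diffop, 'a ugl) tensor"]
    by (simp add: right_diff_distrib)
  have "mat_pow rho_shift (Suc k) a None =
      (\<Sum>c\<in>UNIV. rho_shift a c * (ratio_col c * ?X k + lift_col ?w c))"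
    by (simp add: Suc neg)
  also have "\<dots> = ratio_col a * ?X (Suc k)
      + lift_col (\<lambda>c. - (\<Sum>j\<in>UNIV. t_ratio j \<otimes> r_gl (Suc k) c j)) a"
    by (simp only: rho_shift_step row col X)
  finally show ?case by (cases a) simp_all
qed

text \<open>The first two terms of the Horner sum combine, which is why \<open>t_0 \<partial>_0\<close> appears in the final
  formulas and their sums start at \<open>m = 2\<close>.\<close>

lemma R2_minus_pd_t_r: "R2 - pd_t_r 0 = t_pd None None \<otimes> 1"
proof -
  have "pd_t_r 0 = (\<Sum>i\<in>UNIV. pd_t i i \<otimes> (1 :: 'a ugl))"
    by (simp add: pd_t_r_def r_gl_0 if_distrib[of "\<lambda>x. _ \<otimes> x"] cong: if_cong)
  hence "R2 - pd_t_r 0 = (euler + of_nat CARD('a) - (\<Sum>i\<in>UNIV. pd_t i i :: 'a diffop)) \<otimes> 1"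
    by (simp only: R2_def tens_diff_left tens_sum_left)
  thus ?thesis
    by (simp add: euler_def UNIV_option_sum pd_t_eq sum.distrib)
qed

lemma mat_pow_rho_shift_None':
  assumes "k \<ge> 1"
  shows "mat_pow rho_shift k a None =
     ratio_col a * (R2 ^ (k - 1) * (t_pd None None \<otimes> 1) - (\<Sum>m=2..k. R2 ^ (k - m) * pd_t_r (m - 1)))
     - lift_col (\<lambda>c. \<Sum>j\<in>UNIV. t_ratio j \<otimes> r_gl k c j) a"
proof -
  obtain l where k: "k = Suc l" using assms by (cases k) auto
  have "(\<Sum>m=1..k. R2 ^ (k - m) * pd_t_r (m - 1) :: ('a diffop, 'a ugl) tensor) =
      R2 ^ (k - 1) * pd_t_r 0 + (\<Sum>m=2..k. R2 ^ (k - m) * pd_t_r (m - 1))"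
    using sum.atLeast_Suc_atMost[OF assms,
        of "\<lambda>m. R2 ^ (k - m) * pd_t_r (m - 1) :: ('a diffop, 'a ugl) tensor"]
    by (simp add: numeral_2_eq_2)
  moreover have "R2 ^ k = R2 ^ (k - 1) * (R2 :: ('a diffop, 'a ugl) tensor)"
    by (simp add: k power_commutes)
  ultimately show ?thesis
    unfolding mat_pow_rho_shift_None R2_minus_pd_t_r[symmetric]
    by (simp add: right_diff_distrib distrib_left)
qed

section \<open>Reinstating the central shift\<close>

lemma sum_triangle_swap:
  fixes F :: "nat \<Rightarrow> nat \<Rightarrow> 'a::comm_monoid_add"
  shows "(\<Sum>g=0..k. \<Sum>m=l..k-g. F m g) = (\<Sum>m=l..k. \<Sum>g=0..k-m. F m g)"
  unfolding sum.Sigma[OF finite_atLeastAtMost ballI[OF finite_atLeastAtMost]]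
  by (rule sum.reindex_bij_witness[of _ prod.swap prod.swap]) auto

text \<open>Collects the binomial coefficients around each term of the Horner sums, as in the stated
  formulas.\<close>

lemma binomial_horner_swap:
  fixes y z :: "'a::ring_1"
  shows "(\<Sum>g=0..k. of_nat (k choose g) * y ^ g * (\<Sum>m=l..k-g. z ^ (k - g - m) * x m)) =
     (\<Sum>m=l..k. (\<Sum>g=0..k-m. of_nat (k choose g) * y ^ g * z ^ (k - m - g)) * x m)"
  unfolding sum_distrib_left sum_distrib_right sum_triangle_swap
  by (intro sum.cong) (simp_all add: mult.assoc add.commute)

lemma rho_r_gl_binomial:
  "rho (r_gl k a b) = (\<Sum>g=0..k. of_nat (k choose g) * R1 ^ g * mat_pow rho_shift (k - g) a b)"
  unfolding rho_r_gl rho_gen_eq_shift by (rule mat_pow_add_central[OF R1_commutes_rho_shift])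

lemma binomial_coeff_commutes:
  fixes x y z :: "'a::ring_1"
  assumes "y * x = x * y" "z * x = x * z"
  shows "(\<Sum>g\<in>A. of_nat (c g) * y ^ g * z ^ d g) * x = x * (\<Sum>g\<in>A. of_nat (c g) * y ^ g * z ^ d g)"
proof -
  have "of_nat (c g) * y ^ g * z ^ d g * x = x * (of_nat (c g) * y ^ g * z ^ d g)" for g
    by (simp only: mult_binomial_term[OF assms(1)])
       (simp only: mult.assoc power_commuting_commutes[OF assms(2)])
  thus ?thesis by (simp add: sum_distrib_left sum_distrib_right)
qed

lemma f_elt_commutes:
  "R1 * f_elt m a b = f_elt m a b * R1" "R2 * f_elt m a b = f_elt m a b * R2"
  by (simp_all add: f_elt_def sum_distrib_left sum_distrib_right R1_commutes_tens_r_gl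
        R2_commutes_tens euler_commutes_t_pd)

lemma rho_r_gl_Some:
  "rho (r_gl k a (Some b)) =
     (\<Sum>m=1..k. f_elt m a b * (\<Sum>g=0..k-m. of_nat (k choose g) * R1 ^ g * R2 ^ (k - m - g)))
     + (\<Sum>g=0..k. of_nat (k choose g) * R1 ^ g * lift_col (\<lambda>c. 1 \<otimes> r_gl (k - g) c b) a)"
proof -
  have pow: "R2 ^ i * ratio_col a = ratio_col a * R2 ^ i" for i
    by (simp add: power_commuting_commutes R2_commutes_ratio_col)
  have "ratio_col a * (\<Sum>m=1..j. R2 ^ (j - m) * f_elt m None b) =
      (\<Sum>m=1..j. R2 ^ (j - m) * f_elt m a b)" for j
    unfolding f_elt_ratio_col[of _ a] sum_distrib_left mult.assoc[symmetric] pow ..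
  thus ?thesis
    unfolding rho_r_gl_binomial mat_pow_rho_shift_Some
    by (simp only: distrib_left sum.distrib binomial_horner_swap
          binomial_coeff_commutes[OF f_elt_commutes])
qed

lemma rho_r_gl_None:
  assumes "k \<ge> 1"
  shows "rho (r_gl k a None) =
     (\<Sum>g=0..k-1. of_nat (k choose g) * R1 ^ g * R2 ^ (k - 1 - g)) * (t_pd a None \<otimes> 1)
     + R1 ^ k * (if a = None then 1 else 0)
     - (\<Sum>g=0..k-1. of_nat (k choose g) * R1 ^ g *
          lift_col (\<lambda>c. \<Sum>j\<in>UNIV. t_ratio j \<otimes> r_gl (k - g) c j) a)
     - ratio_col a * (\<Sum>m=2..k. (\<Sum>g=0..k-m. of_nat (k choose g) * R1 ^ g * R2 ^ (k - m - g)) *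
                        pd_t_r (m - 1))"
proof -
  obtain l where k: "k = Suc l" using assms by (cases k) auto
  have coeff: "of_nat (k choose g) * R1 ^ g * (ratio_col a * x) =
      ratio_col a * (of_nat (k choose g) * R1 ^ g * x)" for g x
    by (rule mult_binomial_term[OF R1_commutes_ratio_col, symmetric])
  have "rho (r_gl k a None) =
      (\<Sum>g=0..l. of_nat (k choose g) * R1 ^ g * mat_pow rho_shift (k - g) a None)
      + R1 ^ k * (if a = None then 1 else 0)"
    \<comment> \<open>The zeroth power of \<open>N\<close> is split off: the closed form in terms of \<open>t_0 \<partial>_0\<close> needs a positive
      exponent.\<close>
    unfolding rho_r_gl_binomial by (simp add: k)
  also have "(\<Sum>g=0..l. of_nat (k choose g) * R1 ^ g * mat_pow rho_shift (k - g) a None) =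
      (\<Sum>g=0..l. ratio_col a * (of_nat (k choose g) * R1 ^ g * R2 ^ (l - g) * (t_pd None None \<otimes> 1))
         - ratio_col a * (of_nat (k choose g) * R1 ^ g * (\<Sum>m=2..k-g. R2 ^ (k - g - m) * pd_t_r (m - 1)))
         - of_nat (k choose g) * R1 ^ g * lift_col (\<lambda>c. \<Sum>j\<in>UNIV. t_ratio j \<otimes> r_gl (k - g) c j) a)"
    (is "_ = (\<Sum>g=0..l. ratio_col a * ?A g - ratio_col a * ?B g - ?C g)")
  proof (intro sum.cong refl)
    fix g assume "g \<in> {0..l}"
    hence g: "k - g \<ge> 1" "k - g - 1 = l - g" by (auto simp: k)
    show "of_nat (k choose g) * R1 ^ g * mat_pow rho_shift (k - g) a None =
        ratio_col a * ?A g - ratio_col a * ?B g - ?C g"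
      unfolding mat_pow_rho_shift_None'[OF g(1)] g(2)
      by (simp only: right_diff_distrib coeff) (simp only: mult.assoc)
  qed
  also have "\<dots> = ratio_col a * (\<Sum>g=0..l. ?A g) - ratio_col a * (\<Sum>g=0..l. ?B g) - (\<Sum>g=0..l. ?C g)"
    by (simp add: sum_subtractf sum_distrib_left)
  also have "ratio_col a * (\<Sum>g=0..l. ?A g) =
      (\<Sum>g=0..l. of_nat (k choose g) * R1 ^ g * R2 ^ (l - g)) * (t_pd a None \<otimes> 1)"
    unfolding sum_distrib_right[symmetric] mult.assoc[symmetric]
      binomial_coeff_commutes[OF R1_commutes_ratio_col R2_commutes_ratio_col, symmetric]
    by (simp add: mult.assoc ratio_col_mult_tens t_rat_mult_t_pd_None)
  also have "(\<Sum>g=0..l. ?B g) = (\<Sum>g=0..k. ?B g)"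
    by (simp add: k)
  also have "\<dots> = (\<Sum>m=2..k. (\<Sum>g=0..k-m. of_nat (k choose g) * R1 ^ g * R2 ^ (k - m - g)) *
                        pd_t_r (m - 1))"
    by (rule binomial_horner_swap)
  finally show ?thesis by (simp add: k algebra_simps)
qed

theorem mainTheorem7:
  fixes k :: nat and a b :: "'n::finite"
  assumes "k \<ge> 1"
  shows "rho (r_gl k (Some a) (Some b)) =
           (\<Sum>m=1..k. f_elt m (Some a) b *
              (\<Sum>g=0..k-m. of_nat (k choose g) * R1 ^ g * R2 ^ (k - m - g)))
           + (\<Sum>g=0..k. of_nat (k choose g) * R1 ^ g * (1 \<otimes> r_gl (k - g) a b))
    \<and> rho (r_gl k (Some a) None) =
           (\<Sum>g=0..k-1. of_nat (k choose g) * R1 ^ g * R2 ^ (k - 1 - g)) *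
             (t_pd (Some a) None \<otimes> 1)
           - (\<Sum>g=0..k-1. of_nat (k choose g) * R1 ^ g *
                (\<Sum>j\<in>UNIV. t_ratio j \<otimes> r_gl (k - g) a j))
           - (t_ratio a \<otimes> 1) *
             (\<Sum>m=2..k. (\<Sum>g=0..k-m. of_nat (k choose g) * R1 ^ g * R2 ^ (k - m - g)) *
                (\<Sum>i\<in>UNIV. \<Sum>j\<in>UNIV. pd_t i j \<otimes> r_gl (m - 1) i j))
    \<and> rho (r_gl k None (Some b)) =
           (\<Sum>m=1..k. f_elt m None b *
              (\<Sum>g=0..k-m. of_nat (k choose g) * R1 ^ g * R2 ^ (k - m - g)))
    \<and> rho (r_gl k (None :: 'n option) None) =
           (\<Sum>g=0..k-1. of_nat (k choose g) * R1 ^ g * R2 ^ (k - 1 - g)) *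
             (t_pd None None \<otimes> 1)
           + R1 ^ k
           - (\<Sum>m=2..k. (\<Sum>g=0..k-m. of_nat (k choose g) * R1 ^ g * R2 ^ (k - m - g)) *
                (\<Sum>i\<in>UNIV. \<Sum>j\<in>UNIV. pd_t i j \<otimes> r_gl (m - 1) i j))"
  using rho_r_gl_Some[of k "Some a" b] rho_r_gl_Some[of k None b]
    rho_r_gl_None[OF assms, of "Some a"] rho_r_gl_None[OF assms, of "None :: 'n option"]
  by (simp add: ratio_col_def pd_t_r_def tens_one)

end
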